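(* Let $H$ be a nonzero complex Hilbert space and let $\Omega\subset H$ be a bounded domain. Let $u,v\in\mathcal{PSH}(\Omega)\cap C^2(\overline\Omega)$. Assume: (1) $mI\le D'D''v(z)\le MI$ for all $z\in\Omega$ and some constants $0<m\le M$; (2) for every $z\in\Omega$ and every unit vector $x\in H$, $\Delta_x(D'D''v(z))\le\Delta_x(D'D''u(z))$. If in addition $S\left(\frac Mm\right)u\le v$ on $\partial\Omega$, then $S\left(\frac Mm\right)u-v$ is plurisubharmonic and nonpositive on $\Omega$.
   Context: The inner product of $H$ is linear in the first variable; $A\ge B$ for self-adjoint operators means $\langle(A-B)x,x\rangle\ge0$ for all $x$. Specht's ratio: $S(h):=\frac{(h-1)h^{1/(h-1)}}{e\log h}$ for $h>0$, $h\ne1$, and $S(1):=1$. Plurisubharmonic: for $\Omega\subset H$ open, $\mathcal{PSH}(\Omega)$ is the set of upper semicontinuous $u:\Omega\to[-\infty,\infty)$, not identically $-\infty$ on any component of $\Omega$, such that $u(z)\le\frac1{2\pi}\int_0^{2\pi}u(z+e^{i\theta}h)\,d\theta$ whenever $z\in\Omega$, $h\in H$ and $z+\lambda h\in\Omega$ for all $|\lambda|\le1$. $C^2(\overline\Omega)$ denotes functions on $\overline\Omega$ of class $C^2$ up to the boundary (of class $C^2$ in $\Omega$, with the function and its derivatives up to order two extending continuously to $\overline\Omega$). Levi form: for a $C^2$ function $u$ with second real Fréchet differential $D^2u(a)$, $4D'D''u(a)(s,t)=D^2u(a)(s,t)+D^2u(a)(is,it)+iD^2u(a)(s,it)-iD^2u(a)(is,t)$;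 this form is identified with the bounded operator $D'D''u(a)$ given by $\langle D'D''u(a)s,t\rangle=D'D''u(a)(s,t)$ (so $D'D''\|z\|^2=I$). For $u$ plurisubharmonic this operator is positive. Fujii--Seo determinant: for a bounded positive operator $A\ge0$ and a unit vector $x$, $\Delta_x(A):=\exp\bigl(\lim_{\varepsilon\to0^+}\langle\log(A+\varepsilon I)x,x\rangle\bigr)$, with $\exp(-\infty)=0$ (this equals $\exp(\langle(\log A)x,x\rangle)$ if $A$ is invertible). *)

theory Defs
  imports "HOL-Analysis.Analysis" "HOL-Computational_Algebra.Polynomial"
begin

section \<open>Complex Hilbert spaces\<close>

text \<open>
  The norm, the topology and the real Frechet calculus are those of the underlying real inner
  product space, whose inner product is the real part of the complex one.  The complex inner
  product is linear in its first argument; its positive definiteness is inherited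
  from \<^class>\<open>real_inner\<close>.
\<close>

class complex_inner_space = real_inner +
  fixes scaleC :: "complex \<Rightarrow> 'a \<Rightarrow> 'a"
    and cinner :: "'a \<Rightarrow> 'a \<Rightarrow> complex"
  assumes scaleC_add_right: "scaleC a (x + y) = scaleC a x + scaleC a y"
    and scaleC_add_left: "scaleC (a + b) x = scaleC a x + scaleC b x"
    and scaleC_scaleC: "scaleC a (scaleC b x) = scaleC (a * b) x"
    and scaleR_eq_scaleC: "scaleR r x = scaleC (complex_of_real r) x"
    and cinner_add_left: "cinner (x + y) z = cinner x z + cinner y z"
    and cinner_scaleC_left: "cinner (scaleC a x) y = a * cinner x y"
    and cinner_commute: "cinner x y = cnj (cinner y x)"
    and inner_eq_Re_cinner: "inner x y = Re (cinner x y)"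

class complex_hilbert_space = complex_inner_space + complete_space

instantiation complex :: complex_hilbert_space
begin

definition scaleC_complex :: "complex \<Rightarrow> complex \<Rightarrow> complex"
  where "scaleC_complex a x = a * x"

definition cinner_complex :: "complex \<Rightarrow> complex \<Rightarrow> complex"
  where "cinner_complex x y = x * cnj y"

instance
  by standard
    (auto simp: scaleC_complex_def cinner_complex_def inner_complex_def algebra_simps scaleR_conv_of_real)

end

section \<open>Operators and the continuous functional calculus\<close>

text \<open>
  Bounded operators are elements of \<^typ>\<open>'a \<Rightarrow>\<^sub>L 'a\<close>, which are a priori only real linear.
  The operators considered below are defined through complex sesquilinear forms and are
  therefore complex linear.
\<close>

definition op_le :: "('a::complex_inner_space \<Rightarrow>\<^sub>L 'a) \<Rightarrow> ('a \<Rightarrow>\<^sub>L 'a) \<Rightarrow> bool"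
  where "op_le B A \<longleftrightarrow> (\<forall>x. cinner (blinfun_apply (A - B) x) x \<in> nonneg_Reals)"

definition scalar_op :: "complex \<Rightarrow> ('a::complex_inner_space \<Rightarrow>\<^sub>L 'a)"
  where "scalar_op c = Blinfun (scaleC c)"

definition op_spectrum :: "('a::complex_inner_space \<Rightarrow>\<^sub>L 'a) \<Rightarrow> complex set"
  where "op_spectrum A =
    {c. \<not> (\<exists>B. B o\<^sub>L (A - scalar_op c) = id_blinfun \<and> (A - scalar_op c) o\<^sub>L B = id_blinfun)}"

definition op_poly :: "real poly \<Rightarrow> ('a::real_normed_vector \<Rightarrow>\<^sub>L 'a) \<Rightarrow> ('a \<Rightarrow>\<^sub>L 'a)"
  where "op_poly p A = (\<Sum>i\<le>degree p. coeff p i *\<^sub>R (((o\<^sub>L) A) ^^ i) id_blinfun)"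

text \<open>
  \<open>op_fun f A\<close> is \<open>f(A)\<close> for a self-adjoint \<open>A\<close> and a real function \<open>f\<close> continuous on the
  spectrum of \<open>A\<close>: the common limit in operator norm of \<open>p\<^sub>n(A)\<close> over all sequences of real
  polynomials \<open>p\<^sub>n\<close> that converge to \<open>f\<close> uniformly on the (real) spectrum.
\<close>

definition op_fun ::
    "(real \<Rightarrow> real) \<Rightarrow> ('a::complex_inner_space \<Rightarrow>\<^sub>L 'a) \<Rightarrow> ('a \<Rightarrow>\<^sub>L 'a)"
  where "op_fun f A = (THE B. \<forall>p :: nat \<Rightarrow> real poly.
    uniform_limit {t. complex_of_real t \<in> op_spectrum A} (\<lambda>n. poly (p n)) f sequentially
      \<longrightarrow> (\<lambda>n. op_poly (p n) A) \<longlonglongrightarrow> B)"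

section \<open>Fujii--Seo determinant and Specht's ratio\<close>

definition exp_ereal :: "ereal \<Rightarrow> ereal"
  where "exp_ereal r =
    (if r = -\<infinity> then 0 else if r = \<infinity> then \<infinity> else ereal (exp (real_of_ereal r)))"

text \<open>
  For positive \<open>A\<close> the operator \<open>log (A + \<epsilon>I)\<close> is self-adjoint, so the inner product below
  is real and taking its real part is only a coercion.
\<close>

definition fs_det :: "'a::complex_inner_space \<Rightarrow> ('a \<Rightarrow>\<^sub>L 'a) \<Rightarrow> ereal"
  where "fs_det x A = exp_ereal (Lim (at_right (0::real))
    (\<lambda>\<epsilon>. ereal (Re (cinner (blinfun_apply (op_fun ln (A + \<epsilon> *\<^sub>R id_blinfun)) x) x))))"

definition specht :: "real \<Rightarrow> real"
  where "specht h =
    (if h = 1 then 1 else ((h - 1) * h powr (1 / (h - 1))) / (exp 1 * ln h))"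

section \<open>Frechet differentials and the Levi form\<close>

definition fderiv ::
    "('a::real_normed_vector \<Rightarrow> 'b::real_normed_vector) \<Rightarrow> 'a \<Rightarrow> ('a \<Rightarrow>\<^sub>L 'b)"
  where "fderiv f a = (THE D. (f has_derivative blinfun_apply D) (at a))"

definition C2_closure :: "'a::real_normed_vector set \<Rightarrow> ('a \<Rightarrow> real) \<Rightarrow> bool"
  where "C2_closure \<Omega> u \<longleftrightarrow>
    (\<forall>z\<in>\<Omega>. u differentiable (at z) \<and> fderiv u differentiable (at z)) \<and>
    continuous_on (closure \<Omega>) u \<and>
    (\<exists>g. continuous_on (closure \<Omega>) g \<and> (\<forall>z\<in>\<Omega>. g z = fderiv u z)) \<and>
    (\<exists>g. continuous_on (closure \<Omega>) g \<and> (\<forall>z\<in>\<Omega>. g z = fderiv (fderiv u) z))"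

definition D2 :: "('a::real_normed_vector \<Rightarrow> real) \<Rightarrow> 'a \<Rightarrow> 'a \<Rightarrow> 'a \<Rightarrow> real"
  where "D2 u a s t = blinfun_apply (blinfun_apply (fderiv (fderiv u) a) s) t"

definition levi_form ::
    "('a::complex_inner_space \<Rightarrow> real) \<Rightarrow> 'a \<Rightarrow> 'a \<Rightarrow> 'a \<Rightarrow> complex"
  where "levi_form u a s t =
    (complex_of_real (D2 u a s t)
      + complex_of_real (D2 u a (scaleC \<i> s) (scaleC \<i> t))
      + \<i> * complex_of_real (D2 u a s (scaleC \<i> t))
      - \<i> * complex_of_real (D2 u a (scaleC \<i> s) t)) / 4"

definition levi_op :: "('a::complex_inner_space \<Rightarrow> real) \<Rightarrow> 'a \<Rightarrow> ('a \<Rightarrow>\<^sub>L 'a)"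
  where "levi_op u a = (THE T. \<forall>s t. cinner (blinfun_apply T s) t = levi_form u a s t)"

section \<open>Plurisubharmonic functions\<close>

definition usc_on :: "'a::topological_space set \<Rightarrow> ('a \<Rightarrow> ereal) \<Rightarrow> bool"
  where "usc_on S f \<longleftrightarrow> (\<forall>z\<in>S. \<forall>c. f z < c \<longrightarrow> (\<forall>\<^sub>F w in at z within S. f w < c))"

text \<open>
  The integral of an extended-real function as the difference of the integrals of its
  positive and negative parts (\<^const>\<open>e2ennreal\<close> truncates negative values to \<open>0\<close>).  An upper
  semicontinuous function with values in \<open>[-\<infinity>,\<infinity>)\<close> is bounded above on a circle, so only the
  second integral can be infinite, and the value is then \<open>-\<infinity>\<close>.
\<close>

definition circle_mean :: "('a::complex_inner_space \<Rightarrow> ereal) \<Rightarrow> 'a \<Rightarrow> 'a \<Rightarrow> ereal"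
  where "circle_mean f z h = ereal (1 / (2 * pi)) *
    (enn2ereal (\<integral>\<^sup>+\<theta>\<in>{0..2*pi}. e2ennreal (f (z + scaleC (cis \<theta>) h)) \<partial>lborel)
      - enn2ereal (\<integral>\<^sup>+\<theta>\<in>{0..2*pi}. e2ennreal (- f (z + scaleC (cis \<theta>) h)) \<partial>lborel))"

definition plurisubharmonic_on :: "'a::complex_inner_space set \<Rightarrow> ('a \<Rightarrow> ereal) \<Rightarrow> bool"
  where "plurisubharmonic_on \<Omega> f \<longleftrightarrow>
    (\<forall>z\<in>\<Omega>. f z < \<infinity>) \<and>
    usc_on \<Omega> f \<and>
    (\<forall>C\<in>components \<Omega>. \<exists>z\<in>C. f z \<noteq> -\<infinity>) \<and>
    (\<forall>z\<in>\<Omega>. \<forall>h. (\<forall>c. cmod c \<le> 1 \<longrightarrow> z + scaleC c h \<in> \<Omega>) \<longrightarrow> f z \<le> circle_mean f z h)"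

end

theory Submission
  imports Defs "HOL-Computational_Algebra.Fundamental_Theorem_Algebra"
begin

text \<open>
  Fix \<open>z\<close> and write \<open>A\<close> and \<open>B\<close> for the Levi operators of \<open>v\<close> and \<open>u\<close> at \<open>z\<close> and \<open>S\<close> for Specht's
  ratio \<open>S(M/m)\<close>.  For every unit vector \<open>x\<close>
  \<open>\<langle>Ax,x\<rangle> \<le> S \<Delta>\<^sub>x(A) \<le> S \<Delta>\<^sub>x(B) \<le> S \<langle>Bx,x\<rangle>\<close>.
  The middle inequality is the hypothesis on the determinants.  The last one is Jensen's inequality
  for the logarithm: replace \<open>log\<close> by its tangent at \<open>\<langle>Bx,x\<rangle> + \<epsilon>\<close> (\<open>fs_det_le_form\<close>).  The first one
  is a reverse Jensen inequality (\<open>form_le_specht_fs_det\<close>): on \<open>[m,M]\<close> the concave function \<open>log\<close> lies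
  above its chord \<open>at + b\<close>, so \<open>\<Delta>\<^sub>x(A) \<ge> exp (a\<langle>Ax,x\<rangle> + b)\<close>, and \<open>S\<close> is the maximum of
  \<open>t / exp (at + b)\<close>.  Hence the Levi form of \<open>w = Su - v\<close> is nonnegative, that is, \<open>w\<close> has a
  nonnegative Laplacian on every complex line.

  The rest for \<open>w\<close> is potential theory on complex lines, and all of it comes from the maximum
  principle for compact sets of complex numbers (\<open>laplacian_nonneg_max_principle\<close>).  Applied to
  averages of rotations of \<open>w\<close>, it gives the sub-mean-value inequality, so \<open>w\<close> is plurisubharmonic;
  applied to a complex line through a point of \<open>\<Omega>\<close>, which meets the closure of \<open>\<Omega>\<close> in a compact
  set although that closure itself need not be compact, it gives \<open>w \<le> 0\<close>.

  The determinants are controlled in three steps.  The Levi operators exist by Riesz representation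
  (\<open>levi_op_representation\<close>), and they are symmetric because second derivatives are
  (\<open>second_derivative_symmetric\<close>).  The one of \<open>u\<close> is positive, since otherwise \<open>-u\<close> would satisfy a
  strict sub-mean-value inequality on a small disc (\<open>plurisubharmonic_imp_levi_op_nonneg\<close>).  The
  logarithm is then a norm limit of polynomials in the operator (\<open>op_fun_tendsto\<close>), and it inherits
  inequalities from them: a polynomial that is nonnegative on the spectrum of a symmetric operator
  has a nonnegative quadratic form (\<open>op_poly_nonneg\<close>).  Only the real part of the inner product
  enters, so this calculus is developed on real Hilbert spaces.
\<close>

section \<open>Operators on a real Hilbert space and polynomials in them\<close>

lemma inner_blinfun_le:
  fixes A :: "'a::real_inner \<Rightarrow>\<^sub>L 'a"
  shows "inner (blinfun_apply A y) y \<le> norm A * (norm y)\<^sup>2"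
  using norm_cauchy_schwarz[of "A y" y] mult_right_mono[OF norm_blinfun[of A y], of "norm y"]
  by (simp add: power2_eq_square)

text \<open>
  Summing up to any bound on the degree lets two polynomials be treated with the same index set.
\<close>

lemma op_poly_eq_sum:
  assumes "degree p \<le> n"
  shows "op_poly p A = (\<Sum>i\<le>n. coeff p i *\<^sub>R (((o\<^sub>L) A) ^^ i) id_blinfun)"
  unfolding op_poly_def
  using assms by (intro sum.mono_neutral_left) (auto intro!: le_degree simp: coeff_eq_0)

lemma op_poly_0 [simp]: "op_poly 0 A = 0"
  by (simp add: op_poly_def)

lemma op_poly_pCons: "op_poly (pCons c p) A = c *\<^sub>R id_blinfun + (A o\<^sub>L op_poly p A)"
proof -
  have "op_poly (pCons c p) A
      = (\<Sum>i\<le>Suc (degree p). coeff (pCons c p) i *\<^sub>R (((o\<^sub>L) A) ^^ i) id_blinfun)"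
    by (intro op_poly_eq_sum) (simp add: degree_pCons_le)
  also have "\<dots> = c *\<^sub>R id_blinfun
      + (\<Sum>i\<le>degree p. coeff p i *\<^sub>R (A o\<^sub>L (((o\<^sub>L) A) ^^ i) id_blinfun))"
    by (subst sum.atMost_Suc_shift) simp
  also have "(\<Sum>i\<le>degree p. coeff p i *\<^sub>R (A o\<^sub>L (((o\<^sub>L) A) ^^ i) id_blinfun))
      = A o\<^sub>L op_poly p A"
    by (simp add: op_poly_def bounded_bilinear.sum_right[OF bounded_bilinear_blinfun_compose]
        bounded_bilinear.scaleR_right[OF bounded_bilinear_blinfun_compose])
  finally show ?thesis .
qed

lemma op_poly_const: "op_poly [:c:] A = c *\<^sub>R id_blinfun"
  by (simp add: op_poly_pCons)

lemma op_poly_linear: "op_poly [:c, b:] A = c *\<^sub>R id_blinfun + b *\<^sub>R A"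
proof (rule blinfun_eqI)
  fix x
  show "blinfun_apply (op_poly [:c, b:] A) x = blinfun_apply (c *\<^sub>R id_blinfun + b *\<^sub>R A) x"
    by (simp add: op_poly_pCons op_poly_const blinfun.bilinear_simps)
qed

lemma op_poly_add: "op_poly (p + q) A = op_poly p A + op_poly q A"
proof -
  define n where "n = max (degree p) (degree q)"
  have "degree (p + q) \<le> n" "degree p \<le> n" "degree q \<le> n"
    using degree_add_le_max[of p q] by (auto simp: n_def)
  then show ?thesis
    by (simp add: op_poly_eq_sum[of _ n] scaleR_left_distrib sum.distrib)
qed

lemma op_poly_smult: "op_poly (smult c p) A = c *\<^sub>R op_poly p A"
  using degree_smult_le[of c p]
  by (simp add: op_poly_eq_sum[of "smult c p" "degree p"] op_poly_eq_sum[of p "degree p"]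
      scaleR_sum_right)

lemma op_poly_diff: "op_poly (p - q) A = op_poly p A - op_poly q A"
proof -
  have "op_poly (p - q) A + op_poly q A = op_poly p A"
    by (simp flip: op_poly_add)
  then show ?thesis by (simp add: eq_diff_eq)
qed

lemma op_poly_mult: "op_poly (p * q) A = op_poly p A o\<^sub>L op_poly q A"
proof (induction p)
  case (pCons c p)
  show ?case
    by (rule blinfun_eqI)
      (simp add: mult_pCons_left op_poly_add op_poly_smult op_poly_pCons pCons.IH
        blinfun.bilinear_simps)
qed (simp add: blinfun_eqI)

text \<open>
  Through this the logarithms of all shifts of \<open>A\<close> can be compared on the single spectrum of \<open>A\<close>.
\<close>

lemma op_poly_shift: "op_poly (p \<circ>\<^sub>p [:e, 1:]) A = op_poly p (A + e *\<^sub>R id_blinfun)"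
proof (induction p)
  case (pCons c p)
  show ?case
    by (rule blinfun_eqI)
      (simp add: pcompose_pCons op_poly_add op_poly_mult op_poly_smult op_poly_const op_poly_linear
        op_poly_pCons pCons.IH blinfun.bilinear_simps)
qed simp

definition symmetric_op :: "('a::real_inner \<Rightarrow>\<^sub>L 'a) \<Rightarrow> bool"
  where "symmetric_op A \<longleftrightarrow> (\<forall>x y. inner (blinfun_apply A x) y = inner x (blinfun_apply A y))"

definition invertible_op :: "('a::real_normed_vector \<Rightarrow>\<^sub>L 'a) \<Rightarrow> bool"
  where "invertible_op A \<longleftrightarrow> (\<exists>B. B o\<^sub>L A = id_blinfun \<and> A o\<^sub>L B = id_blinfun)"

definition real_spectrum :: "('a::real_normed_vector \<Rightarrow>\<^sub>L 'a) \<Rightarrow> real set"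
  where "real_spectrum A = {t. \<not> invertible_op (A - t *\<^sub>R id_blinfun)}"

lemma symmetric_op_add_scaleR:
  "symmetric_op A \<Longrightarrow> symmetric_op (A + e *\<^sub>R id_blinfun)"
  by (simp add: symmetric_op_def blinfun.bilinear_simps inner_left_distrib inner_right_distrib)

text \<open>
  The induction needs that \<open>A\<close> commutes with its polynomials, which is read off from the
  commutativity of polynomial multiplication.
\<close>

lemma symmetric_op_poly:
  assumes "symmetric_op A"
  shows "symmetric_op (op_poly p A)"
proof (induction p)
  case 0
  show ?case by (simp add: symmetric_op_def)
next
  case (pCons c p)
  have 1: "op_poly (pCons c p) A = c *\<^sub>R id_blinfun + (op_poly p A o\<^sub>L A)"
  proof -
    have "pCons c p = [:c:] + p * [:0, 1:]" by simp
    then show ?thesis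
      by (simp only: op_poly_add op_poly_const op_poly_mult op_poly_linear) simp
  qed
  have *: "blinfun_apply (op_poly (pCons c p) A) x
      = c *\<^sub>R x + blinfun_apply (op_poly p A) (blinfun_apply A x)"
    "blinfun_apply (op_poly (pCons c p) A) x
      = c *\<^sub>R x + blinfun_apply A (blinfun_apply (op_poly p A) x)" for x
    by (subst 1 op_poly_pCons, simp add: blinfun.add_left blinfun.scaleR_left)+
  show ?case
    unfolding symmetric_op_def
  proof (intro allI)
    fix x y
    show "inner (blinfun_apply (op_poly (pCons c p) A) x) y
        = inner x (blinfun_apply (op_poly (pCons c p) A) y)"
      using pCons.IH assms unfolding symmetric_op_def
      by (subst *(1), subst *(2)) (simp add: inner_left_distrib inner_right_distrib)
  qed
qed

lemma invertible_op_id: "c \<noteq> 0 \<Longrightarrow> invertible_op (c *\<^sub>R id_blinfun)"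
  unfolding invertible_op_def
  by (intro exI[of _ "(1/c) *\<^sub>R id_blinfun"]) (auto intro!: blinfun_eqI simp: blinfun.bilinear_simps)

lemma invertible_op_compose:
  assumes "invertible_op A" "invertible_op B"
  shows "invertible_op (A o\<^sub>L B)"
proof -
  obtain A' B' where A: "A' o\<^sub>L A = id_blinfun" "A o\<^sub>L A' = id_blinfun"
    and B: "B' o\<^sub>L B = id_blinfun" "B o\<^sub>L B' = id_blinfun"
    using assms by (auto simp: invertible_op_def)
  have "A' (A x) = x" "A (A' x) = x" for x
    using A by (metis blinfun_apply_blinfun_compose blinfun_apply_id_blinfun id_apply)+
  moreover have "B' (B x) = x" "B (B' x) = x" for x
    using B by (metis blinfun_apply_blinfun_compose blinfun_apply_id_blinfun id_apply)+
  ultimately show ?thesis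
    unfolding invertible_op_def
    by (intro exI[of _ "B' o\<^sub>L A'"]) (auto intro!: blinfun_eqI)
qed

text \<open>
  Lax--Milgram.  Since \<open>\<langle>Ax,x\<rangle> \<ge> c\<parallel>x\<parallel>\<^sup>2\<close>, the map \<open>x \<mapsto> x - r(Ax - y)\<close> is a contraction for a small
  \<open>r > 0\<close>, and its fixed point solves \<open>Ax = y\<close>.  The same bound makes the inverse bounded.
\<close>

lemma invertible_op_coercive:
  fixes A :: "'a::{real_inner,complete_space} \<Rightarrow>\<^sub>L 'a"
  assumes "0 < c" and coercive: "\<And>x. c * (norm x)\<^sup>2 \<le> inner (blinfun_apply A x) x"
  shows "invertible_op A"
proof -
  have lower: "c * norm x \<le> norm (A x)" for x
  proof (cases "x = 0")
    case False
    have "c * norm x * norm x \<le> norm (A x) * norm x"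
      using coercive[of x] norm_cauchy_schwarz[of "A x" x] by (simp add: power2_eq_square mult.assoc)
    then show ?thesis using False by simp
  qed simp
  have surj: "\<exists>x. A x = y" for y
  proof -
    define K where "K = norm A + c"
    have K: "0 < K" "c \<le> K"
      using \<open>0 < c\<close> norm_ge_zero[of A] unfolding K_def by linarith+
    have AK: "norm (A x) \<le> K * norm x" for x
    proof -
      have "0 \<le> c * norm x" using \<open>0 < c\<close> by simp
      then show ?thesis
        using norm_blinfun[of A x] unfolding K_def distrib_right by linarith
    qed
    \<comment> \<open>this \<open>r\<close> minimizes \<open>1 - 2rc + r\<^sup>2K\<^sup>2\<close>, a bound for the squared Lipschitz constant\<close>
    define r where "r = c / K\<^sup>2"
    define f where "f = (\<lambda>x. x - r *\<^sub>R (A x - y))"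
    define q where "q = sqrt (1 - c\<^sup>2 / K\<^sup>2)"
    have cK: "c\<^sup>2 / K\<^sup>2 \<le> 1" "0 < c\<^sup>2 / K\<^sup>2"
      using K \<open>0 < c\<close> by (auto simp: power_mono)
    have contr: "norm (x - r *\<^sub>R A x) \<le> q * norm x" for x
    proof -
      have "(norm (x - r *\<^sub>R A x))\<^sup>2 = (norm x)\<^sup>2 - 2 * r * inner (A x) x + r\<^sup>2 * (norm (A x))\<^sup>2"
        unfolding power2_norm_eq_inner
        by (simp add: inner_diff_left inner_diff_right inner_commute power2_eq_square algebra_simps)
      also have "\<dots> \<le> (norm x)\<^sup>2 - 2 * r * (c * (norm x)\<^sup>2) + r\<^sup>2 * (K * norm x)\<^sup>2"
      proof -
        have "r * (c * (norm x)\<^sup>2) \<le> r * inner (A x) x"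
          using coercive[of x] K \<open>0 < c\<close> by (intro mult_left_mono) (auto simp: r_def)
        moreover have "r\<^sup>2 * (norm (A x))\<^sup>2 \<le> r\<^sup>2 * (K * norm x)\<^sup>2"
          using AK[of x] by (intro mult_left_mono power_mono) auto
        ultimately show ?thesis by simp
      qed
      also have "\<dots> = (1 - c\<^sup>2 / K\<^sup>2) * (norm x)\<^sup>2"
        using K by (simp add: r_def field_simps power2_eq_square)
      also have "\<dots> = (q * norm x)\<^sup>2"
        using cK by (simp add: q_def power_mult_distrib)
      finally show ?thesis
        by (rule power2_le_imp_le) (use cK in \<open>simp add: q_def\<close>)
    qed
    have "0 \<le> q" "q < 1"
      using cK by (auto simp: q_def)
    moreover have "dist (f x) (f z) \<le> q * dist x z" for x z
    proof -
      have "f x - f z = (x - z) - r *\<^sub>R A (x - z)"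
        by (simp add: f_def blinfun.bilinear_simps algebra_simps)
      then show ?thesis using contr[of "x - z"] by (simp add: dist_norm)
    qed
    ultimately obtain x where "f x = x"
      using banach_fix_type[of q f] by blast
    moreover have "r \<noteq> 0" using K \<open>0 < c\<close> by (simp add: r_def)
    ultimately show ?thesis by (auto simp: f_def)
  qed
  have inj: "x = z" if "A x = A z" for x z
    using lower[of "x - z"] that \<open>0 < c\<close>
    by (auto simp: blinfun.diff_right) (metis mult_le_0_iff norm_le_zero_iff not_le eq_iff_diff_eq_0)
  define B where "B = (\<lambda>y. SOME x. A x = y)"
  have AB: "A (B y) = y" for y
    unfolding B_def using surj someI_ex by meson
  have BA: "B (A x) = x" for x
    using AB inj by blast
  have "bounded_linear B"
  proof (rule bounded_linear_intro[where K = "1/c"])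
    show "B (x + y) = B x + B y" for x y
      by (rule inj) (simp add: AB blinfun.add_right)
    show "B (t *\<^sub>R x) = t *\<^sub>R B x" for t x
      by (rule inj) (simp add: AB blinfun.scaleR_right)
    show "norm (B x) \<le> norm x * (1/c)" for x
      using lower[of "B x"] \<open>0 < c\<close> by (simp add: AB field_simps)
  qed
  then show ?thesis
    unfolding invertible_op_def using AB BA
    by (intro exI[of _ "Blinfun B"]) (auto intro!: blinfun_eqI simp: bounded_linear_Blinfun_apply)
qed

lemma invertible_op_uminus: "invertible_op (- A) \<Longrightarrow> invertible_op A"
proof -
  assume "invertible_op (- A)"
  then obtain B where "B o\<^sub>L (- A) = id_blinfun" "(- A) o\<^sub>L B = id_blinfun"
    by (auto simp: invertible_op_def)
  then have "(- B) o\<^sub>L A = id_blinfun" "A o\<^sub>L (- B) = id_blinfun"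
    by (simp_all add: bounded_bilinear.minus_left[OF bounded_bilinear_blinfun_compose]
      bounded_bilinear.minus_right[OF bounded_bilinear_blinfun_compose])
  then show ?thesis by (auto simp: invertible_op_def)
qed

text \<open>
  For \<open>T \<ge> 0\<close> one has \<open>\<parallel>Tx\<parallel>\<^sup>2 \<le> K\<langle>Tx,x\<rangle>\<close>, obtained by evaluating the form at \<open>Kx - Tx\<close>; invertibility
  bounds \<open>\<parallel>Tx\<parallel>\<close> below by a multiple of \<open>\<parallel>x\<parallel>\<close>.
\<close>

lemma nonneg_invertible_op_coercive:
  fixes T :: "'a::real_inner \<Rightarrow>\<^sub>L 'a"
  assumes sym: "symmetric_op T" and nonneg: "\<And>x. 0 \<le> inner (blinfun_apply T x) x"
    and inv: "invertible_op T"
  shows "\<exists>d>0. \<forall>x. d * (norm x)\<^sup>2 \<le> inner (blinfun_apply T x) x"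
proof -
  obtain B where B: "B o\<^sub>L T = id_blinfun"
    using inv by (auto simp: invertible_op_def)
  define K where "K = norm T + 1"
  define L where "L = norm B + 1"
  have pos: "K > 0" "L > 0"
    using norm_ge_zero[of T] norm_ge_zero[of B] unfolding K_def L_def by linarith+
  have up: "(norm (T x))\<^sup>2 \<le> K * inner (T x) x" for x
  proof -
    let ?y = "T x"
    have 1: "inner (T ?y) x = inner ?y ?y"
      using sym unfolding symmetric_op_def by simp
    have 2: "inner (T ?y) ?y \<le> K * (norm ?y)\<^sup>2"
      using inner_blinfun_le[of T ?y] zero_le_power2[of "norm ?y"]
      unfolding K_def distrib_right by linarith
    have "0 \<le> inner (T (K *\<^sub>R x - ?y)) (K *\<^sub>R x - ?y)" by (rule nonneg)
    also have "\<dots> = K\<^sup>2 * inner ?y x - 2 * K * (norm ?y)\<^sup>2 + inner (T ?y) ?y"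
    proof -
      have "inner (T ?y) x = inner ?y ?y" "inner ?y ?y = (norm ?y)\<^sup>2"
        by (simp_all add: 1 power2_norm_eq_inner)
      then show ?thesis
        by (simp add: blinfun.diff_right blinfun.scaleR_right inner_diff_left inner_diff_right
            power2_eq_square algebra_simps)
    qed
    finally have "K * (K * inner ?y x) - K * (norm ?y)\<^sup>2 \<ge> 0"
      using 2 by (simp add: power2_eq_square mult.assoc)
    then have "K * (norm ?y)\<^sup>2 \<le> K * (K * inner ?y x)" by linarith
    then show ?thesis using pos by simp
  qed
  have low: "(norm x)\<^sup>2 \<le> L\<^sup>2 * (norm (T x))\<^sup>2" for x
  proof -
    have "B (T x) = x" using B by (metis blinfun_apply_blinfun_compose blinfun_apply_id_blinfun id_apply)
    then have "norm x \<le> L * norm (T x)"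
      using norm_blinfun[of B "T x"] norm_ge_zero[of "T x"] unfolding L_def distrib_right
      by (simp add: add_increasing2)
    then have "(norm x)\<^sup>2 \<le> (L * norm (T x))\<^sup>2"
      by (rule power_mono) simp
    then show ?thesis by (simp add: power_mult_distrib)
  qed
  have "1 / (L\<^sup>2 * K) * (norm x)\<^sup>2 \<le> inner (T x) x" for x
  proof -
    have "(norm x)\<^sup>2 \<le> L\<^sup>2 * (K * inner (T x) x)"
      using low[of x] up[of x] mult_left_mono[OF up[of x], of "L\<^sup>2"] by simp
    then show ?thesis using pos by (simp add: field_simps)
  qed
  then show ?thesis using pos by (intro exI[of _ "1 / (L\<^sup>2 * K)"]) auto
qed

section \<open>Spectrum and functional calculus of symmetric operators\<close>

lemma spectrum_subset_interval:
  fixes A :: "'a::{real_inner,complete_space} \<Rightarrow>\<^sub>L 'a"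
  assumes lo: "\<And>x. \<alpha> * (norm x)\<^sup>2 \<le> inner (blinfun_apply A x) x"
    and hi: "\<And>x. inner (blinfun_apply A x) x \<le> \<beta> * (norm x)\<^sup>2"
  shows "real_spectrum A \<subseteq> {\<alpha>..\<beta>}"
proof
  fix t assume t: "t \<in> real_spectrum A"
  have "invertible_op (A - t *\<^sub>R id_blinfun)" if "t < \<alpha>"
  proof (rule invertible_op_coercive)
    show "0 < \<alpha> - t" using that by simp
    show "(\<alpha> - t) * (norm x)\<^sup>2 \<le> inner (blinfun_apply (A - t *\<^sub>R id_blinfun) x) x" for x
      using lo[of x]
      by (simp add: blinfun.diff_left blinfun.scaleR_left inner_diff_left left_diff_distrib
          power2_norm_eq_inner)
  qed
  moreover have "invertible_op (A - t *\<^sub>R id_blinfun)" if "\<beta> < t"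
  proof (rule invertible_op_uminus, rule invertible_op_coercive)
    show "0 < t - \<beta>" using that by simp
    show "(t - \<beta>) * (norm x)\<^sup>2 \<le> inner (blinfun_apply (- (A - t *\<^sub>R id_blinfun)) x) x" for x
      using hi[of x]
      by (simp add: blinfun.diff_left blinfun.minus_left blinfun.scaleR_left inner_diff_left
          left_diff_distrib power2_norm_eq_inner)
  qed
  ultimately show "t \<in> {\<alpha>..\<beta>}"
    using t by (force simp: real_spectrum_def)
qed

lemma map_poly_of_real_add:
  "map_poly complex_of_real (p + q) = map_poly complex_of_real p + map_poly complex_of_real q"
  by (rule poly_eqI) (simp add: coeff_map_poly)

lemma map_poly_of_real_mult:
  "map_poly complex_of_real (p * q) = map_poly complex_of_real p * map_poly complex_of_real q"
  by (rule poly_eqI) (simp add: coeff_map_poly coeff_mult)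

lemma poly_map_of_real:
  "poly (map_poly complex_of_real p) (complex_of_real t) = complex_of_real (poly p t)"
  by (induction p) (simp_all add: map_poly_pCons)

text \<open>
  Half of the spectral mapping theorem.  The polynomial is factored over the reals: a factor
  \<open>X - r\<close> is invertible at \<open>A\<close> by assumption on \<open>r\<close>, and a quadratic factor \<open>(X - a)\<^sup>2 + b\<^sup>2\<close> with
  \<open>b \<noteq> 0\<close> is coercive at \<open>A\<close> because \<open>A\<close> is symmetric.
\<close>

lemma invertible_op_poly:
  fixes A :: "'a::{real_inner,complete_space} \<Rightarrow>\<^sub>L 'a"
  assumes sym: "symmetric_op A"
  shows "q \<noteq> 0 \<Longrightarrow> (\<And>t. t \<in> real_spectrum A \<Longrightarrow> poly q t \<noteq> 0) \<Longrightarrow> invertible_op (op_poly q A)"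
proof (induction "degree q" arbitrary: q rule: less_induct)
  case less
  have factor: "invertible_op (op_poly q A)"
    if eq: "q = s * q1" and s: "degree s > 0" "invertible_op (op_poly s A)" for s q1
  proof -
    have nz: "s \<noteq> 0" "q1 \<noteq> 0" using less.prems(1) eq by auto
    have "invertible_op (op_poly q1 A)"
    proof (rule less.hyps)
      show "degree q1 < degree q"
        using nz s by (simp add: eq degree_mult_eq)
      show "poly q1 t \<noteq> 0" if "t \<in> real_spectrum A" for t
        using less.prems(2)[OF that] by (simp add: eq)
    qed (rule nz)
    then show ?thesis
      unfolding eq op_poly_mult using s(2) by (intro invertible_op_compose)
  qed
  consider (const) "degree q = 0" | (real) r where "poly q r = 0"
    | (complex) "degree q > 0" "\<And>r. poly q r \<noteq> 0"
    by blast
  then show ?case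
  proof cases
    case const
    then obtain c where "q = [:c:]" by (meson degree_eq_zeroE)
    then show ?thesis
      using less.prems(1) by (auto simp: op_poly_const intro: invertible_op_id)
  next
    case real
    then obtain q1 where q1: "q = [:-r, 1:] * q1"
      by (auto simp: poly_eq_0_iff_dvd dvd_def)
    have "r \<notin> real_spectrum A"
      using less.prems(2) real by blast
    moreover have "op_poly [:-r, 1:] A = A - r *\<^sub>R id_blinfun"
      by (simp add: op_poly_linear)
    ultimately show ?thesis
      by (intro factor[OF q1]) (auto simp: real_spectrum_def)
  next
    case complex
    have "\<not> constant (poly (map_poly complex_of_real q))"
      using complex(1) by (simp add: constant_degree degree_map_poly)
    then obtain c where c: "poly (map_poly complex_of_real q) c = 0"
      using fundamental_theorem_of_algebra by blast
    define a b where "a = Re c" and "b = Im c"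
    have "b \<noteq> 0"
    proof
      assume "b = 0"
      then have "c = complex_of_real a" by (simp add: a_def b_def complex_eq_iff)
      then show False using c complex(2)[of a] by (simp add: poly_map_of_real)
    qed
    define Q where "Q = [:a\<^sup>2 + b\<^sup>2, - 2 * a, 1:]"
    have Qc: "poly (map_poly complex_of_real Q) c = 0"
      by (simp add: Q_def a_def b_def map_poly_pCons complex_eq_iff algebra_simps power2_eq_square)
    have "Q dvd q"
    proof -
      \<comment> \<open>the remainder is real and linear and vanishes at the nonreal \<open>c\<close>, so it is zero\<close>
      define R where "R = q mod Q"
      have "degree R < 2"
        unfolding R_def using degree_mod_less'[of Q q] by (cases "q mod Q = 0") (auto simp: Q_def)
      then obtain r0 r1 where R: "R = [:r0, r1:]"
      proof -
        assume "degree R < 2"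
        then have "R = [:coeff R 0, coeff R 1:]"
          by (intro poly_eqI) (auto simp: coeff_pCons coeff_eq_0 split: nat.split)
        then show thesis by (rule that)
      qed
      have "q = q div Q * Q + R" by (simp add: R_def)
      then have "map_poly complex_of_real q
          = map_poly complex_of_real (q div Q) * map_poly complex_of_real Q + map_poly complex_of_real R"
        by (metis map_poly_of_real_add map_poly_of_real_mult)
      then have "poly (map_poly complex_of_real R) c = 0"
        using c Qc by simp
      then have "complex_of_real r0 + c * complex_of_real r1 = 0"
        by (simp add: R map_poly_pCons)
      then have "R = 0"
        using \<open>b \<noteq> 0\<close> by (auto simp: complex_eq_iff b_def R)
      then show ?thesis by (simp add: R_def mod_eq_0_iff_dvd)
    qed
    then obtain q1 where q1: "q = Q * q1" by (auto simp: dvd_def)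
    have "invertible_op (op_poly Q A)"
    proof (rule invertible_op_coercive)
      show "0 < b\<^sup>2" using \<open>b \<noteq> 0\<close> by simp
      fix x
      have "inner (op_poly Q A x) x = (a\<^sup>2 + b\<^sup>2) * inner x x - 2 * a * inner (A x) x + inner (A (A x)) x"
        by (simp add: Q_def op_poly_pCons blinfun.bilinear_simps inner_diff_left inner_add_left)
      also have "inner (A (A x)) x = inner (A x) (A x)"
        using sym by (simp add: symmetric_op_def)
      finally have "inner (op_poly Q A x) x = (norm (A x - a *\<^sub>R x))\<^sup>2 + b\<^sup>2 * (norm x)\<^sup>2"
        unfolding power2_norm_eq_inner
        by (simp add: inner_diff_left inner_diff_right inner_commute algebra_simps power2_eq_square)
      then show "b\<^sup>2 * (norm x)\<^sup>2 \<le> inner (op_poly Q A x) x" by simp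
    qed
    then show ?thesis by (intro factor[OF q1]) (simp_all add: Q_def)
  qed
qed

text \<open>
  The infimum \<open>\<mu>\<close> of the form over the unit sphere lies in the spectrum: otherwise the
  nonnegative operator \<open>T - \<mu>I\<close> would be invertible, hence coercive, and \<open>\<mu>\<close> could be increased.
\<close>

lemma spectrum_below_form:
  fixes T :: "'a::real_inner \<Rightarrow>\<^sub>L 'a"
  assumes sym: "symmetric_op T" and "x0 \<noteq> 0"
  shows "\<exists>\<mu>\<in>real_spectrum T. \<mu> * (norm x0)\<^sup>2 \<le> inner (blinfun_apply T x0) x0"
proof -
  define S where "S = {inner (T x) x | x. norm x = 1}"
  define \<mu> where "\<mu> = Inf S"
  have "S \<noteq> {}"
    using \<open>x0 \<noteq> 0\<close> by (auto simp: S_def intro!: exI[of _ "x0 /\<^sub>R norm x0"])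
  have bdd: "bdd_below S"
  proof (rule bdd_belowI)
    fix s assume "s \<in> S"
    then obtain x where x: "norm x = 1" "s = inner (T x) x" by (auto simp: S_def)
    have "\<bar>inner (T x) x\<bar> \<le> norm T * norm x * norm x"
      using Cauchy_Schwarz_ineq2[of "T x" x] mult_right_mono[OF norm_blinfun[of T x], of "norm x"]
      by simp
    then show "- norm T \<le> s" using x by simp
  qed
  have low: "\<mu> * (norm x)\<^sup>2 \<le> inner (T x) x" for x
  proof (cases "x = 0")
    case False
    have "inner (T (x /\<^sub>R norm x)) (x /\<^sub>R norm x) \<in> S"
      using False by (auto simp: S_def intro!: exI[of _ "x /\<^sub>R norm x"])
    then have "\<mu> \<le> inner (T (x /\<^sub>R norm x)) (x /\<^sub>R norm x)"
      unfolding \<mu>_def by (intro cInf_lower bdd)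
    then show ?thesis
      using False by (simp add: blinfun.scaleR_right field_simps power2_eq_square)
  qed (simp add: blinfun.zero_right)
  have "\<mu> \<in> real_spectrum T"
  proof (rule ccontr)
    let ?T = "T - \<mu> *\<^sub>R id_blinfun"
    assume "\<mu> \<notin> real_spectrum T"
    then have "invertible_op ?T" by (simp add: real_spectrum_def)
    moreover have "symmetric_op ?T"
      using symmetric_op_add_scaleR[OF sym, of "- \<mu>"] by simp
    moreover have form: "inner (?T x) x = inner (T x) x - \<mu> * (norm x)\<^sup>2" for x
      by (simp add: blinfun.diff_left blinfun.scaleR_left inner_diff_left power2_norm_eq_inner)
    then have "0 \<le> inner (?T x) x" for x
      using low[of x] by simp
    ultimately obtain d where d: "d > 0" "d * (norm x)\<^sup>2 \<le> inner (?T x) x" for x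
      using nonneg_invertible_op_coercive by blast
    have "\<mu> + d \<le> Inf S"
    proof (rule cInf_greatest)
      fix s assume "s \<in> S"
      then obtain x where x: "norm x = 1" "s = inner (T x) x" by (auto simp: S_def)
      then show "\<mu> + d \<le> s" using d(2)[of x] unfolding form by simp
    qed (rule \<open>S \<noteq> {}\<close>)
    then show False using d(1) by (simp add: \<mu>_def)
  qed
  then show ?thesis using low by blast
qed

text \<open>
  If the form took a negative value, \<open>p(A)\<close> would have a spectral value \<open>\<mu> < 0\<close>, and by spectral
  mapping \<open>p\<close> would take the value \<open>\<mu>\<close> on the spectrum of \<open>A\<close>.
\<close>

lemma op_poly_nonneg:
  fixes A :: "'a::{real_inner,complete_space} \<Rightarrow>\<^sub>L 'a"
  assumes sym: "symmetric_op A" and p: "\<And>t. t \<in> real_spectrum A \<Longrightarrow> 0 \<le> poly p t"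
  shows "0 \<le> inner (blinfun_apply (op_poly p A) x) x"
proof (rule ccontr)
  assume neg: "\<not> 0 \<le> inner (blinfun_apply (op_poly p A) x) x"
  then have "x \<noteq> 0" by auto
  then obtain \<mu> where \<mu>: "\<mu> \<in> real_spectrum (op_poly p A)"
      "\<mu> * (norm x)\<^sup>2 \<le> inner (blinfun_apply (op_poly p A) x) x"
    using spectrum_below_form[OF symmetric_op_poly[OF sym, of p]] by blast
  have "\<mu> * (norm x)\<^sup>2 < 0" using \<mu>(2) neg by simp
  then have "\<mu> < 0"
    by (simp add: mult_less_0_iff)
  have "\<not> invertible_op (op_poly (p - [:\<mu>:]) A)"
    using \<mu>(1) by (simp add: real_spectrum_def op_poly_diff op_poly_const)
  then have "p - [:\<mu>:] = 0 \<or> (\<exists>t\<in>real_spectrum A. poly (p - [:\<mu>:]) t = 0)"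
    using invertible_op_poly[OF sym] by blast
  then have "\<exists>t\<in>real_spectrum A. poly (p - [:\<mu>:]) t = 0"
    using spectrum_below_form[OF sym \<open>x \<noteq> 0\<close>] by auto
  then show False using p \<open>\<mu> < 0\<close> by force
qed

text \<open>
  Positivity is applied to \<open>c\<^sup>2 - p\<^sup>2\<close>, because \<open>\<langle>p(A)\<^sup>2x,x\<rangle> = \<parallel>p(A)x\<parallel>\<^sup>2\<close>.
\<close>

lemma norm_op_poly_le:
  fixes A :: "'a::{real_inner,complete_space} \<Rightarrow>\<^sub>L 'a"
  assumes sym: "symmetric_op A" and p: "\<And>t. t \<in> real_spectrum A \<Longrightarrow> \<bar>poly p t\<bar> \<le> c" and "0 \<le> c"
  shows "norm (op_poly p A) \<le> c"
proof (rule norm_blinfun_bound[OF \<open>0 \<le> c\<close>])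
  fix x
  let ?P = "op_poly p A"
  have "0 \<le> inner (op_poly ([:c\<^sup>2:] - p * p) A x) x"
  proof (rule op_poly_nonneg[OF sym])
    fix t assume "t \<in> real_spectrum A"
    from p[OF this] have "\<bar>poly p t\<bar>\<^sup>2 \<le> c\<^sup>2" by (intro power_mono) auto
    then show "0 \<le> poly ([:c\<^sup>2:] - p * p) t" by (simp add: power2_eq_square)
  qed
  also have "\<dots> = (c * norm x)\<^sup>2 - inner (?P (?P x)) x"
    by (simp add: op_poly_diff op_poly_const op_poly_mult blinfun.diff_left blinfun.scaleR_left
        inner_diff_left power_mult_distrib power2_norm_eq_inner)
  also have "inner (?P (?P x)) x = (norm (?P x))\<^sup>2"
    using symmetric_op_poly[OF sym, of p] by (simp add: symmetric_op_def power2_norm_eq_inner)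
  finally have "(norm (?P x))\<^sup>2 \<le> (c * norm x)\<^sup>2" by simp
  then show "norm (?P x) \<le> c * norm x"
    by (rule power2_le_imp_le) (use \<open>0 \<le> c\<close> in simp)
qed

lemma poly_uniform_approx:
  fixes f :: "real \<Rightarrow> real"
  assumes "continuous_on {a..b} f"
  shows "\<exists>p. uniform_limit {a..b} (\<lambda>n. poly (p n)) f sequentially"
proof -
  have "\<exists>p. \<forall>t\<in>{a..b}. \<bar>f t - poly p t\<bar> < 1 / real (Suc n)" for n
  proof -
    obtain g where g: "real_polynomial_function g" "\<And>x. x \<in> {a..b} \<Longrightarrow> \<bar>f x - g x\<bar> < 1 / real (Suc n)"
      using Stone_Weierstrass_real_polynomial_function[OF compact_Icc assms, of "1 / real (Suc n)"] by auto
    then obtain c k where "g = (\<lambda>x. \<Sum>i\<le>k. c i * x ^ i)"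
      using real_polynomial_function_iff_sum by blast
    then have "poly (\<Sum>i\<le>k. monom (c i) i) x = g x" for x
      by (simp add: poly_sum poly_monom)
    then show ?thesis using g(2) by metis
  qed
  then obtain p where p: "\<And>n t. t \<in> {a..b} \<Longrightarrow> \<bar>f t - poly (p n) t\<bar> < 1 / real (Suc n)"
    by metis
  have "uniform_limit {a..b} (\<lambda>n. poly (p n)) f sequentially"
  proof (rule uniform_limitI)
    fix e :: real assume "0 < e"
    then obtain N where N: "inverse (real (Suc N)) < e" using reals_Archimedean by blast
    show "\<forall>\<^sub>F n in sequentially. \<forall>x\<in>{a..b}. dist (poly (p n) x) (f x) < e"
      unfolding eventually_sequentially
    proof (intro exI[of _ N] allI impI ballI)
      fix n x assume "N \<le> n" "x \<in> {a..b}"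
      then have "1 / real (Suc n) \<le> inverse (real (Suc N))" by (simp add: divide_simps)
      then show "dist (poly (p n) x) (f x) < e"
        using p[OF \<open>x \<in> {a..b}\<close>, of n] N by (simp add: dist_real_def abs_minus_commute)
    qed
  qed
  then show ?thesis by blast
qed

lemma real_spectrum_eq_op_spectrum:
  fixes A :: "'a::complex_inner_space \<Rightarrow>\<^sub>L 'a"
  shows "{t. complex_of_real t \<in> op_spectrum A} = real_spectrum A"
proof -
  have "scalar_op (complex_of_real t) = (t *\<^sub>R id_blinfun :: 'a \<Rightarrow>\<^sub>L 'a)" for t
  proof (rule blinfun_eqI)
    have "scaleC (complex_of_real t) = (\<lambda>x::'a. t *\<^sub>R x)"
      by (simp add: scaleR_eq_scaleC)
    then show "scalar_op (complex_of_real t) x = (t *\<^sub>R id_blinfun) x" for x :: 'a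
      by (simp add: scalar_op_def bounded_linear_Blinfun_apply bounded_linear_scaleR_right
          blinfun.scaleR_left)
  qed
  then show ?thesis
    by (simp add: op_spectrum_def real_spectrum_def invertible_op_def)
qed

text \<open>
  This makes the bounded operators on a complex Hilbert space a complete space.
\<close>

instance complex_hilbert_space \<subseteq> banach ..

text \<open>
  By the norm bound, two polynomial sequences with the same uniform limit on the spectrum have
  asymptotically equal values at \<open>A\<close>.  One sequence that converges on \<open>[\<alpha>,\<beta>]\<close> thus determines the
  limit along all sequences, which is the operator described in \<^const>\<open>op_fun\<close>.
\<close>

lemma op_fun_tendsto:
  fixes A :: "'a::complex_hilbert_space \<Rightarrow>\<^sub>L 'a"
  assumes sym: "symmetric_op A"
    and lo: "\<And>x. \<alpha> * (norm x)\<^sup>2 \<le> inner (blinfun_apply A x) x"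
    and hi: "\<And>x. inner (blinfun_apply A x) x \<le> \<beta> * (norm x)\<^sup>2"
    and p: "uniform_limit {\<alpha>..\<beta>} (\<lambda>n. poly (p n)) f sequentially"
  shows "(\<lambda>n. op_poly (p n) A) \<longlonglongrightarrow> op_fun f A"
proof -
  let ?\<sigma> = "real_spectrum A"
  have p\<sigma>: "uniform_limit ?\<sigma> (\<lambda>n. poly (p n)) f sequentially"
    using p spectrum_subset_interval[OF lo hi] by (rule uniform_limit_on_subset)
  have close: "\<exists>N. \<forall>m\<ge>N. \<forall>n\<ge>N. norm (op_poly (q m) A - op_poly (r n) A) < e"
    if "0 < e" and q: "uniform_limit ?\<sigma> (\<lambda>n. poly (q n)) f sequentially"
      and r: "uniform_limit ?\<sigma> (\<lambda>n. poly (r n)) f sequentially" for e q r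
  proof -
    have "\<forall>\<^sub>F n in sequentially. (\<forall>x\<in>?\<sigma>. dist (poly (q n) x) (f x) < e/4) \<and>
        (\<forall>x\<in>?\<sigma>. dist (poly (r n) x) (f x) < e/4)"
      using uniform_limitD[OF q, of "e/4"] uniform_limitD[OF r, of "e/4"] \<open>0 < e\<close>
      by (simp add: eventually_conj)
    then obtain N where N: "\<And>n x. N \<le> n \<Longrightarrow> x \<in> ?\<sigma> \<Longrightarrow> dist (poly (q n) x) (f x) < e/4"
        "\<And>n x. N \<le> n \<Longrightarrow> x \<in> ?\<sigma> \<Longrightarrow> dist (poly (r n) x) (f x) < e/4"
      by (auto simp: eventually_sequentially)
    have "norm (op_poly (q m) A - op_poly (r n) A) < e" if "m \<ge> N" "n \<ge> N" for m n
    proof -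
      have "norm (op_poly (q m - r n) A) \<le> e/2"
      proof (rule norm_op_poly_le[OF sym])
        fix t assume "t \<in> ?\<sigma>"
        then show "\<bar>poly (q m - r n) t\<bar> \<le> e/2"
          using N(1)[OF that(1), of t] N(2)[OF that(2), of t] unfolding dist_real_def poly_diff by linarith
      qed (use \<open>0 < e\<close> in simp)
      then show ?thesis using \<open>0 < e\<close> by (simp add: op_poly_diff)
    qed
    then show ?thesis by blast
  qed
  have "Cauchy (\<lambda>n. op_poly (p n) A)"
    unfolding Cauchy_iff using close[OF _ p\<sigma> p\<sigma>] by blast
  then obtain B where B: "(\<lambda>n. op_poly (p n) A) \<longlonglongrightarrow> B"
    unfolding Cauchy_convergent_iff convergent_def by blast
  have all: "(\<lambda>n. op_poly (q n) A) \<longlonglongrightarrow> B"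
    if q: "uniform_limit ?\<sigma> (\<lambda>n. poly (q n)) f sequentially" for q
  proof -
    have "(\<lambda>n. op_poly (q n) A - op_poly (p n) A) \<longlonglongrightarrow> 0"
    proof (rule LIMSEQ_I)
      fix e :: real assume "0 < e"
      from close[OF this q p\<sigma>] obtain N
        where N: "\<forall>m\<ge>N. \<forall>n\<ge>N. norm (op_poly (q m) A - op_poly (p n) A) < e" ..
      show "\<exists>N. \<forall>n\<ge>N. norm (op_poly (q n) A - op_poly (p n) A - 0) < e"
        unfolding diff_zero by (intro exI[of _ N] allI impI N[rule_format])
    qed
    from tendsto_add[OF this B] show ?thesis by simp
  qed
  have "op_fun f A = B"
    unfolding op_fun_def real_spectrum_eq_op_spectrum
  proof (rule the_equality)
    show "\<forall>p. uniform_limit ?\<sigma> (\<lambda>n. poly (p n)) f sequentially \<longrightarrow> (\<lambda>n. op_poly (p n) A) \<longlonglongrightarrow> B"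
      using all by blast
    show "C = B" if "\<forall>p. uniform_limit ?\<sigma> (\<lambda>n. poly (p n)) f sequentially
        \<longrightarrow> (\<lambda>n. op_poly (p n) A) \<longlonglongrightarrow> C" for C
      using that p\<sigma> B LIMSEQ_unique by blast
  qed
  then show ?thesis using B by simp
qed

text \<open>
  A polynomial approximation of \<open>ln\<close> on \<open>[\<alpha> + e,\<beta> + e]\<close>, composed with the shift by \<open>e\<close>, is at once an
  approximation of \<open>t \<mapsto> ln (t + e)\<close> on \<open>[\<alpha>,\<beta>]\<close> in the operator \<open>A\<close> itself.
\<close>

lemma op_fun_ln_shift_approx:
  fixes A :: "'a::complex_hilbert_space \<Rightarrow>\<^sub>L 'a"
  assumes sym: "symmetric_op A"
    and lo: "\<And>x. \<alpha> * (norm x)\<^sup>2 \<le> inner (blinfun_apply A x) x"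
    and hi: "\<And>x. inner (blinfun_apply A x) x \<le> \<beta> * (norm x)\<^sup>2"
    and "0 < \<alpha> + e"
  shows "\<exists>p. uniform_limit {\<alpha>..\<beta>} (\<lambda>n. poly (p n)) (\<lambda>t. ln (t + e)) sequentially
    \<and> (\<lambda>n. op_poly (p n) A) \<longlonglongrightarrow> op_fun ln (A + e *\<^sub>R id_blinfun)"
proof -
  have "continuous_on {\<alpha> + e..\<beta> + e} (ln :: real \<Rightarrow> real)"
    using \<open>0 < \<alpha> + e\<close> by (intro continuous_on_ln continuous_on_id) auto
  then obtain q where q: "uniform_limit {\<alpha> + e..\<beta> + e} (\<lambda>n. poly (q n)) ln sequentially"
    using poly_uniform_approx by blast
  have form: "inner (blinfun_apply (A + e *\<^sub>R id_blinfun) x) x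
      = inner (blinfun_apply A x) x + e * (norm x)\<^sup>2" for x
    by (simp add: blinfun.add_left blinfun.scaleR_left inner_add_left power2_norm_eq_inner)
  have "(\<lambda>n. op_poly (q n) (A + e *\<^sub>R id_blinfun)) \<longlonglongrightarrow> op_fun ln (A + e *\<^sub>R id_blinfun)"
    by (rule op_fun_tendsto[OF symmetric_op_add_scaleR[OF sym] _ _ q])
      (use lo hi in \<open>simp_all add: form distrib_right\<close>)
  moreover have "uniform_limit {\<alpha>..\<beta>} (\<lambda>n. poly (q n \<circ>\<^sub>p [:e, 1:])) (\<lambda>t. ln (t + e)) sequentially"
    using q unfolding uniform_limit_iff
    by (elim all_forward imp_forward eventually_mono)
      (auto simp: poly_pcompose add.commute dest: bspec[where x = "_ + e"])
  ultimately show ?thesis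
    by (intro exI[of _ "\<lambda>n. q n \<circ>\<^sub>p [:e, 1:]"]) (simp add: op_poly_shift)
qed

text \<open>
  Order passes to the functional calculus: inequalities between functions on a set containing the
  spectrum become inequalities between quadratic forms.
\<close>

lemma form_limit_nonneg:
  fixes A :: "'a::{real_inner,complete_space} \<Rightarrow>\<^sub>L 'a"
  assumes sym: "symmetric_op A" and sub: "real_spectrum A \<subseteq> S"
    and p: "uniform_limit S (\<lambda>n. poly (p n)) f sequentially"
    and B: "(\<lambda>n. op_poly (p n) A) \<longlonglongrightarrow> B"
    and f: "\<And>t. t \<in> S \<Longrightarrow> 0 \<le> f t"
  shows "0 \<le> inner (blinfun_apply B x) x"
proof -
  have lim: "(\<lambda>n. inner (op_poly (p n) A x) x) \<longlonglongrightarrow> inner (B x) x"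
    by (rule tendsto_inner[OF blinfun.tendsto[OF B tendsto_const] tendsto_const])
  have "- e * (norm x)\<^sup>2 \<le> inner (B x) x" if "0 < e" for e
  proof (rule tendsto_lowerbound[OF lim])
    show "\<forall>\<^sub>F n in sequentially. - e * (norm x)\<^sup>2 \<le> inner (op_poly (p n) A x) x"
      using uniform_limitD[OF p \<open>0 < e\<close>]
    proof eventually_elim
      case (elim n)
      have "0 \<le> inner (op_poly (p n + [:e:]) A x) x"
      proof (rule op_poly_nonneg[OF sym])
        fix t assume "t \<in> real_spectrum A"
        then have "t \<in> S" using sub by blast
        then show "0 \<le> poly (p n + [:e:]) t"
          using elim f[of t] by (force simp: dist_real_def)
      qed
      then show ?case
        by (simp add: op_poly_add op_poly_const blinfun.add_left blinfun.scaleR_left inner_add_left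
            power2_norm_eq_inner)
    qed
  qed simp
  then have "- e \<le> inner (B x) x" if "0 < e" for e
  proof -
    have "- (e / ((norm x)\<^sup>2 + 1)) * (norm x)\<^sup>2 \<le> inner (B x) x"
      using \<open>\<And>e. 0 < e \<Longrightarrow> - e * (norm x)\<^sup>2 \<le> inner (B x) x\<close> that
      by (metis add_nonneg_pos divide_pos_pos zero_le_power2 zero_less_one)
    moreover have "e / ((norm x)\<^sup>2 + 1) * (norm x)\<^sup>2 \<le> e"
    proof -
      have "0 < (norm x)\<^sup>2 + 1" by (simp add: add_nonneg_pos)
      then show ?thesis using that by (simp add: divide_simps algebra_simps)
    qed
    ultimately show ?thesis by linarith
  qed
  from this[of "- inner (B x) x / 2"] show ?thesis by linarith
qed

section \<open>The Fujii--Seo determinant and the quadratic form\<close>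

lemma exp_ereal_mono: "a \<le> b \<Longrightarrow> exp_ereal a \<le> exp_ereal b"
  by (cases a; cases b) (auto simp: exp_ereal_def)

lemma op_fun_ln_shift_mono:
  fixes A :: "'a::complex_hilbert_space \<Rightarrow>\<^sub>L 'a"
  assumes sym: "symmetric_op A" and nonneg: "\<And>x. 0 \<le> inner (blinfun_apply A x) x"
    and "0 < e" "e \<le> e'"
  shows "inner (blinfun_apply (op_fun ln (A + e *\<^sub>R id_blinfun)) x) x
    \<le> inner (blinfun_apply (op_fun ln (A + e' *\<^sub>R id_blinfun)) x) x"
proof -
  have lo: "0 * (norm y)\<^sup>2 \<le> inner (A y) y" for y using nonneg by simp
  have hi: "inner (A y) y \<le> norm A * (norm y)\<^sup>2" for y
    by (rule inner_blinfun_le)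
  have pos: "0 < 0 + e" "0 < 0 + e'" using assms by auto
  obtain p p' where p: "uniform_limit {0..norm A} (\<lambda>n. poly (p n)) (\<lambda>t. ln (t + e)) sequentially"
      "(\<lambda>n. op_poly (p n) A) \<longlonglongrightarrow> op_fun ln (A + e *\<^sub>R id_blinfun)"
    and p': "uniform_limit {0..norm A} (\<lambda>n. poly (p' n)) (\<lambda>t. ln (t + e')) sequentially"
      "(\<lambda>n. op_poly (p' n) A) \<longlonglongrightarrow> op_fun ln (A + e' *\<^sub>R id_blinfun)"
    using op_fun_ln_shift_approx[OF sym lo hi pos(1)] op_fun_ln_shift_approx[OF sym lo hi pos(2)]
    by blast
  have "0 \<le> inner (blinfun_apply (op_fun ln (A + e' *\<^sub>R id_blinfun)
      - op_fun ln (A + e *\<^sub>R id_blinfun)) x) x"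
  proof (rule form_limit_nonneg[OF sym spectrum_subset_interval[OF lo hi]])
    show "uniform_limit {0..norm A} (\<lambda>n. poly (p' n - p n)) (\<lambda>t. ln (t + e') - ln (t + e)) sequentially"
      unfolding poly_diff by (rule uniform_limit_minus[OF p'(1) p(1)])
    show "(\<lambda>n. op_poly (p' n - p n) A) \<longlonglongrightarrow>
        op_fun ln (A + e' *\<^sub>R id_blinfun) - op_fun ln (A + e *\<^sub>R id_blinfun)"
      unfolding op_poly_diff by (rule tendsto_diff[OF p'(2) p(2)])
    show "0 \<le> ln (t + e') - ln (t + e)" if "t \<in> {0..norm A}" for t
      using that \<open>0 < e\<close> \<open>e \<le> e'\<close> by (simp add: ln_mono)
  qed
  then show ?thesis by (simp add: blinfun.diff_left inner_diff_left)
qed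

lemma op_poly_le_op_fun_ln_shift:
  fixes A :: "'a::complex_hilbert_space \<Rightarrow>\<^sub>L 'a"
  assumes sym: "symmetric_op A"
    and lo: "\<And>x. \<alpha> * (norm x)\<^sup>2 \<le> inner (blinfun_apply A x) x"
    and hi: "\<And>x. inner (blinfun_apply A x) x \<le> \<beta> * (norm x)\<^sup>2"
    and "0 < \<alpha> + e" and q: "\<And>t. \<alpha> \<le> t \<Longrightarrow> t \<le> \<beta> \<Longrightarrow> poly q t \<le> ln (t + e)"
  shows "inner (blinfun_apply (op_poly q A) x) x
    \<le> inner (blinfun_apply (op_fun ln (A + e *\<^sub>R id_blinfun)) x) x"
proof -
  obtain p where p: "uniform_limit {\<alpha>..\<beta>} (\<lambda>n. poly (p n)) (\<lambda>t. ln (t + e)) sequentially"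
      "(\<lambda>n. op_poly (p n) A) \<longlonglongrightarrow> op_fun ln (A + e *\<^sub>R id_blinfun)"
    using op_fun_ln_shift_approx[OF sym lo hi \<open>0 < \<alpha> + e\<close>] by blast
  have "0 \<le> inner (blinfun_apply (op_fun ln (A + e *\<^sub>R id_blinfun) - op_poly q A) x) x"
  proof (rule form_limit_nonneg[OF sym spectrum_subset_interval[OF lo hi]])
    show "uniform_limit {\<alpha>..\<beta>} (\<lambda>n. poly (p n - q)) (\<lambda>t. ln (t + e) - poly q t) sequentially"
      unfolding poly_diff by (rule uniform_limit_minus[OF p(1) uniform_limit_const])
    show "(\<lambda>n. op_poly (p n - q) A) \<longlonglongrightarrow> op_fun ln (A + e *\<^sub>R id_blinfun) - op_poly q A"
      unfolding op_poly_diff by (rule tendsto_diff[OF p(2) tendsto_const])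
    show "0 \<le> ln (t + e) - poly q t" if "t \<in> {\<alpha>..\<beta>}" for t
      using that q by simp
  qed
  then show ?thesis by (simp add: blinfun.diff_left inner_diff_left)
qed

lemma op_fun_ln_shift_le_op_poly:
  fixes A :: "'a::complex_hilbert_space \<Rightarrow>\<^sub>L 'a"
  assumes sym: "symmetric_op A" and nonneg: "\<And>x. 0 \<le> inner (blinfun_apply A x) x"
    and "0 < e" and q: "\<And>t. 0 \<le> t \<Longrightarrow> ln (t + e) \<le> poly q t"
  shows "inner (blinfun_apply (op_fun ln (A + e *\<^sub>R id_blinfun)) x) x
    \<le> inner (blinfun_apply (op_poly q A) x) x"
proof -
  have lo: "0 * (norm y)\<^sup>2 \<le> inner (A y) y" for y using nonneg by simp
  have hi: "inner (A y) y \<le> norm A * (norm y)\<^sup>2" for y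
    by (rule inner_blinfun_le)
  have pos: "0 < 0 + e" using assms by auto
  obtain p where p: "uniform_limit {0..norm A} (\<lambda>n. poly (p n)) (\<lambda>t. ln (t + e)) sequentially"
      "(\<lambda>n. op_poly (p n) A) \<longlonglongrightarrow> op_fun ln (A + e *\<^sub>R id_blinfun)"
    using op_fun_ln_shift_approx[OF sym lo hi pos] by blast
  have "0 \<le> inner (blinfun_apply (op_poly q A - op_fun ln (A + e *\<^sub>R id_blinfun)) x) x"
  proof (rule form_limit_nonneg[OF sym spectrum_subset_interval[OF lo hi]])
    show "uniform_limit {0..norm A} (\<lambda>n. poly (q - p n)) (\<lambda>t. poly q t - ln (t + e)) sequentially"
      unfolding poly_diff by (rule uniform_limit_minus[OF uniform_limit_const p(1)])
    show "(\<lambda>n. op_poly (q - p n) A) \<longlonglongrightarrow> op_poly q A - op_fun ln (A + e *\<^sub>R id_blinfun)"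
      unfolding op_poly_diff by (rule tendsto_diff[OF tendsto_const p(2)])
    show "0 \<le> poly q t - ln (t + e)" if "t \<in> {0..norm A}" for t
      using that q by simp
  qed
  then show ?thesis by (simp add: blinfun.diff_left inner_diff_left)
qed

text \<open>
  The quantity under the limit increases with \<open>e\<close>, so the limit as \<open>e\<close> decreases to \<open>0\<close> exists
  as an extended real and is the infimum.
\<close>

lemma fs_det_eq_INF:
  fixes A :: "'a::complex_hilbert_space \<Rightarrow>\<^sub>L 'a"
  assumes sym: "symmetric_op A" and nonneg: "\<And>x. 0 \<le> inner (blinfun_apply A x) x"
  shows "fs_det x A = exp_ereal (INF e\<in>{0<..}.
    ereal (inner (blinfun_apply (op_fun ln (A + e *\<^sub>R id_blinfun)) x) x))"
proof -
  define L where "L e = ereal (inner (blinfun_apply (op_fun ln (A + e *\<^sub>R id_blinfun)) x) x)" for e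
  have mono: "L e \<le> L e'" if "0 < e" "e \<le> e'" for e e'
    using op_fun_ln_shift_mono[OF sym nonneg that] by (simp add: L_def)
  have "(L \<longlongrightarrow> (INF e\<in>{0<..}. L e)) (at_right 0)"
  proof (rule decreasing_tendsto)
    show "\<forall>\<^sub>F e in at_right 0. (INF e\<in>{0<..}. L e) \<le> L e"
      using eventually_at_right_less[of "0::real"] by eventually_elim (auto intro: INF_lower)
    fix y assume "(INF e\<in>{0<..}. L e) < y"
    then obtain d where d: "0 < d" "L d < y" by (auto simp: INF_less_iff)
    show "\<forall>\<^sub>F e in at_right 0. L e < y"
      unfolding eventually_at_right_field
      using d le_less_trans[OF mono d(2)] by (intro exI[of _ d]) auto
  qed
  then have "Lim (at_right 0) L = (INF e\<in>{0<..}. L e)"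
    by (intro tendsto_Lim) auto
  then show ?thesis
    unfolding fs_det_def L_def inner_eq_Re_cinner by simp
qed

text \<open>
  Jensen: with \<open>c = \<langle>Ax,x\<rangle> + e\<close>, the tangent of the logarithm at \<open>c\<close> bounds \<open>\<langle>log (A + eI)x,x\<rangle>\<close> by
  \<open>log c\<close>.
\<close>

lemma fs_det_le_form:
  fixes A :: "'a::complex_hilbert_space \<Rightarrow>\<^sub>L 'a"
  assumes sym: "symmetric_op A" and nonneg: "\<And>x. 0 \<le> inner (blinfun_apply A x) x"
    and x: "norm x = 1"
  shows "fs_det x A \<le> ereal (inner (blinfun_apply A x) x)"
proof (rule ereal_le_epsilon2)
  fix e :: real assume "0 < e"
  define c where "c = inner (A x) x + e"
  have "0 < c" using nonneg[of x] \<open>0 < e\<close> by (simp add: c_def)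
  define q where "q = [:ln c + e / c - 1, 1 / c:]"
  have "inner (blinfun_apply (op_fun ln (A + e *\<^sub>R id_blinfun)) x) x \<le> inner (op_poly q A x) x"
  proof (rule op_fun_ln_shift_le_op_poly[OF sym nonneg \<open>0 < e\<close>])
    fix t :: real assume "0 \<le> t"
    have "ln ((t + e) / c) \<le> (t + e) / c - 1"
      using \<open>0 \<le> t\<close> \<open>0 < e\<close> \<open>0 < c\<close> by (intro ln_le_minus_one) auto
    moreover have "ln ((t + e) / c) = ln (t + e) - ln c"
      using \<open>0 \<le> t\<close> \<open>0 < e\<close> \<open>0 < c\<close> by (simp add: ln_div)
    ultimately show "ln (t + e) \<le> poly q t"
      by (simp add: q_def add_divide_distrib)
  qed
  also have "\<dots> = (ln c + e / c - 1) * inner x x + 1 / c * inner (A x) x"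
    by (simp only: q_def op_poly_linear blinfun.add_left blinfun.scaleR_left inner_add_left
        inner_scaleR_left blinfun_apply_id_blinfun id_apply)
  also have "inner x x = 1" using x by (simp flip: power2_norm_eq_inner)
  also have "(ln c + e / c - 1) * 1 + 1 / c * inner (A x) x = ln c + (inner (A x) x + e) / c - 1"
    by (simp add: add_divide_distrib)
  also have "\<dots> = ln c" using \<open>0 < c\<close> by (simp flip: c_def)
  finally have "(INF e\<in>{0<..}. ereal (inner (blinfun_apply (op_fun ln (A + e *\<^sub>R id_blinfun)) x) x))
      \<le> ereal (ln c)"
    using \<open>0 < e\<close> by (intro INF_lower2[of e]) auto
  then have "fs_det x A \<le> exp_ereal (ereal (ln c))"
    unfolding fs_det_eq_INF[OF sym nonneg] by (rule exp_ereal_mono)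
  then show "fs_det x A \<le> ereal (inner (A x) x) + ereal e"
    using \<open>0 < c\<close> by (simp add: exp_ereal_def c_def)
qed

text \<open>
  A minorant \<open>q\<close> of \<open>ln\<close> is also a minorant of \<open>t \<mapsto> ln (t + e)\<close> for every \<open>e > 0\<close>, so the bound
  survives the infimum over \<open>e\<close>.
\<close>

lemma exp_op_poly_form_le_fs_det:
  fixes A :: "'a::complex_hilbert_space \<Rightarrow>\<^sub>L 'a"
  assumes sym: "symmetric_op A" and "0 < \<alpha>"
    and lo: "\<And>x. \<alpha> * (norm x)\<^sup>2 \<le> inner (blinfun_apply A x) x"
    and hi: "\<And>x. inner (blinfun_apply A x) x \<le> \<beta> * (norm x)\<^sup>2"
    and q: "\<And>t. \<alpha> \<le> t \<Longrightarrow> t \<le> \<beta> \<Longrightarrow> poly q t \<le> ln t"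
  shows "ereal (exp (inner (blinfun_apply (op_poly q A) x) x)) \<le> fs_det x A"
proof -
  have nonneg: "0 \<le> inner (A x) x" for x
    using lo[of x] \<open>0 < \<alpha>\<close> by (meson mult_nonneg_nonneg less_imp_le order_trans zero_le_power2)
  have "ereal (inner (op_poly q A x) x)
      \<le> (INF e\<in>{0<..}. ereal (inner (blinfun_apply (op_fun ln (A + e *\<^sub>R id_blinfun)) x) x))"
  proof (rule INF_greatest)
    fix e :: real assume "e \<in> {0<..}"
    then have "0 < e" by simp
    have "poly q t \<le> ln (t + e)" if "\<alpha> \<le> t" "t \<le> \<beta>" for t
    proof -
      have "ln t \<le> ln (t + e)" using that \<open>0 < \<alpha>\<close> \<open>0 < e\<close> by (intro ln_mono) auto
      then show ?thesis using q[OF that] by linarith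
    qed
    then show "ereal (inner (op_poly q A x) x)
        \<le> ereal (inner (blinfun_apply (op_fun ln (A + e *\<^sub>R id_blinfun)) x) x)"
      using op_poly_le_op_fun_ln_shift[OF sym lo hi, of e q x] \<open>0 < \<alpha>\<close> \<open>0 < e\<close> by simp
  qed
  then have "exp_ereal (ereal (inner (op_poly q A x) x)) \<le> fs_det x A"
    unfolding fs_det_eq_INF[OF sym nonneg] by (rule exp_ereal_mono)
  then show ?thesis by (simp add: exp_ereal_def)
qed

lemma specht_pos: "1 \<le> h \<Longrightarrow> 0 < specht h"
  by (auto simp: specht_def intro!: divide_pos_pos mult_pos_pos ln_gt_zero)

text \<open>
  Here \<open>at + b\<close> is the chord of the logarithm over \<open>[m,M]\<close>.  Specht's ratio is exactly the number
  with \<open>S(M/m) exp b = 1 / (ea)\<close>, so the claim reduces to \<open>ac \<le> exp (ac - 1)\<close>.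
\<close>

lemma specht_chord_bound:
  fixes m M a b c :: real
  assumes "0 < m" "m < M"
    and a: "a = (ln M - ln m) / (M - m)" and b: "b = ln m - a * m"
  shows "c \<le> specht (M / m) * exp (a * c + b)"
proof -
  define h where "h = M / m"
  have h: "1 < h" using assms by (simp add: h_def)
  have "0 < ln h" using h by simp
  have lnh: "ln M - ln m = ln h" using assms by (simp add: h_def ln_div)
  have Mm: "M - m = m * (h - 1)" using assms by (simp add: h_def field_simps)
  have "0 < a" unfolding a lnh Mm using h \<open>0 < m\<close> by simp
  have "exp b = m * exp (- (ln h / (h - 1)))"
  proof -
    have "a * m = ln h / (h - 1)"
      unfolding a lnh Mm using \<open>0 < m\<close> by simp
    then show ?thesis using \<open>0 < m\<close> by (simp add: b exp_diff exp_minus divide_inverse)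
  qed
  then have "h powr (1 / (h - 1)) * exp b = m"
    using h by (simp add: powr_def exp_minus)
  then have "specht h * exp b = (h - 1) * m / (exp 1 * ln h)"
    using h by (simp add: specht_def)
  also have "\<dots> = 1 / (exp 1 * a)"
    unfolding a lnh Mm using h \<open>0 < m\<close> by (simp add: field_simps)
  finally have S: "specht h * exp b = 1 / (exp 1 * a)" .
  have "a * c \<le> exp (a * c - 1)"
    using exp_ge_add_one_self[of "a * c - 1"] by simp
  then have "c \<le> exp (a * c - 1) / a"
    using \<open>0 < a\<close> by (simp add: field_simps)
  also have "\<dots> = exp (a * c) * (1 / (exp 1 * a))"
    by (simp add: exp_diff)
  also have "\<dots> = specht h * exp (a * c + b)"
    by (simp flip: S add: exp_add)
  finally show ?thesis by (simp add: h_def)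
qed

text \<open>
  Reverse Jensen inequality.  For \<open>m = M\<close> the chord degenerates and the constant \<open>log m\<close> takes its
  place.
\<close>

lemma form_le_specht_fs_det:
  fixes A :: "'a::complex_hilbert_space \<Rightarrow>\<^sub>L 'a"
  assumes sym: "symmetric_op A" and m: "0 < m" "m \<le> M"
    and lo: "\<And>x. m * (norm x)\<^sup>2 \<le> inner (blinfun_apply A x) x"
    and hi: "\<And>x. inner (blinfun_apply A x) x \<le> M * (norm x)\<^sup>2"
    and x: "norm x = 1"
  shows "ereal (inner (blinfun_apply A x) x) \<le> ereal (specht (M / m)) * fs_det x A"
proof -
  have xx: "inner x x = 1" using x by (simp flip: power2_norm_eq_inner)
  have "\<exists>r. inner (A x) x \<le> specht (M / m) * exp r \<and> ereal (exp r) \<le> fs_det x A"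
  proof (cases "m = M")
    case True
    have "ereal (exp (inner (op_poly [:ln m:] A x) x)) \<le> fs_det x A"
      by (rule exp_op_poly_form_le_fs_det[OF sym m(1) lo hi]) (use m in \<open>simp add: ln_mono\<close>)
    moreover have "inner (op_poly [:ln m:] A x) x = ln m"
      by (simp add: op_poly_const blinfun.scaleR_left xx)
    ultimately show ?thesis
      using hi[of x] x True m by (intro exI[of _ "ln m"]) (simp add: specht_def)
  next
    case False
    then have "m < M" using m by simp
    define a b where "a = (ln M - ln m) / (M - m)" and "b = ln m - a * m"
    have "ereal (exp (inner (op_poly [:b, a:] A x) x)) \<le> fs_det x A"
    proof (rule exp_op_poly_form_le_fs_det[OF sym m(1) lo hi])
      fix t assume t: "m \<le> t" "t \<le> M"
      have "concave_on {m..M} ln"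
        using ln_concave unfolding concave_on_def
        by (rule convex_on_subset) (use m in auto)
      then have "ln t \<ge> (ln M - ln m) / (M - m) * (t - m) + ln m"
        by (rule concave_onD_Icc') (use t in auto)
      then have "ln t \<ge> a * (t - m) + ln m" unfolding a_def .
      then show "poly [:b, a:] t \<le> ln t"
        by (simp add: b_def algebra_simps)
    qed
    moreover have "inner (op_poly [:b, a:] A x) x = a * inner (A x) x + b"
      by (simp add: op_poly_linear blinfun.scaleR_left blinfun.add_left inner_add_left xx)
    ultimately show ?thesis
      using specht_chord_bound[OF m(1) \<open>m < M\<close> a_def b_def, of "inner (A x) x"] by metis
  qed
  then obtain r where r: "inner (A x) x \<le> specht (M / m) * exp r" "ereal (exp r) \<le> fs_det x A"
    by blast
  have "0 \<le> ereal (specht (M / m))" using specht_pos[of "M / m"] m by simp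
  then have "ereal (specht (M / m)) * ereal (exp r) \<le> ereal (specht (M / m)) * fs_det x A"
    using r(2) by (intro ereal_mult_left_mono)
  then show ?thesis using r(1) by (metis ereal_less_eq(3) order_trans times_ereal.simps(1))
qed

lemma form_le_specht_form:
  fixes A B :: "'a::complex_hilbert_space \<Rightarrow>\<^sub>L 'a"
  assumes "symmetric_op A" "0 < m" "m \<le> M"
    and "\<And>x. m * (norm x)\<^sup>2 \<le> inner (blinfun_apply A x) x"
    and "\<And>x. inner (blinfun_apply A x) x \<le> M * (norm x)\<^sup>2"
    and "symmetric_op B" "\<And>x. 0 \<le> inner (blinfun_apply B x) x"
    and det: "\<And>x. norm x = 1 \<Longrightarrow> fs_det x A \<le> fs_det x B"
  shows "inner (blinfun_apply A x) x \<le> specht (M / m) * inner (blinfun_apply B x) x"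
proof -
  have unit: "inner (A y) y \<le> specht (M / m) * inner (B y) y" if "norm y = 1" for y
  proof -
    have S: "0 \<le> ereal (specht (M / m))" using specht_pos[of "M / m"] assms by simp
    have "ereal (inner (A y) y) \<le> ereal (specht (M / m)) * fs_det y A"
      using form_le_specht_fs_det assms(1-5) that by blast
    also have "\<dots> \<le> ereal (specht (M / m)) * fs_det y B"
      using det[OF that] S by (rule ereal_mult_left_mono)
    also have "\<dots> \<le> ereal (specht (M / m)) * ereal (inner (B y) y)"
      using fs_det_le_form[OF assms(6,7) that] S by (rule ereal_mult_left_mono)
    finally show ?thesis by simp
  qed
  show ?thesis
  proof (cases "x = 0")
    case False
    have "inner (C x) x = (norm x)\<^sup>2 * inner (C (x /\<^sub>R norm x)) (x /\<^sub>R norm x)"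
      for C :: "'a \<Rightarrow>\<^sub>L 'a"
      using False
      by (simp add: blinfun.scaleR_right power2_eq_square field_simps)
    then show ?thesis
      using mult_left_mono[OF unit[of "x /\<^sub>R norm x"], of "(norm x)\<^sup>2"] False
      by (simp add: mult.left_commute)
  qed (simp add: blinfun.zero_right)
qed

section \<open>Functions of a complex variable with nonnegative Laplacian\<close>

text \<open>
  Second derivatives are taken along single real lines, since the second derivative test for maxima
  needs no more and the notion passes at once to rotations and sums.
\<close>

definition second_deriv_along :: "(complex \<Rightarrow> real) \<Rightarrow> complex \<Rightarrow> complex \<Rightarrow> real \<Rightarrow> bool"
  where "second_deriv_along f a k q \<longleftrightarrow> (\<exists>g d. 0 < d \<and>
    (\<forall>t. \<bar>t\<bar> < d \<longrightarrow> ((\<lambda>t. f (a + of_real t * k)) has_real_derivative g t) (at t)) \<and>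
    (g has_real_derivative q) (at 0))"

text \<open>
  Asking for \<open>0 \<le> q(k) + q(ik)\<close> in every direction \<open>k\<close>, and not only for \<open>k = 1\<close>, makes the condition
  invariant under rotations without any appeal to \<open>q\<close> being a quadratic form.
\<close>

definition laplacian_nonneg_at :: "(complex \<Rightarrow> real) \<Rightarrow> complex \<Rightarrow> bool"
  where "laplacian_nonneg_at f a \<longleftrightarrow>
    (\<exists>q. \<forall>k. second_deriv_along f a k (q k) \<and> 0 \<le> q k + q (\<i> * k))"

lemma second_deriv_along_add:
  assumes "second_deriv_along f a k p" "second_deriv_along g a k q"
  shows "second_deriv_along (\<lambda>x. f x + g x) a k (p + q)"
proof -
  obtain f' d where f: "0 < d"
      "\<And>t. \<bar>t\<bar> < d \<Longrightarrow> ((\<lambda>t. f (a + of_real t * k)) has_real_derivative f' t) (at t)"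
      "(f' has_real_derivative p) (at 0)"
    using assms(1) unfolding second_deriv_along_def by blast
  obtain g' e where g: "0 < e"
      "\<And>t. \<bar>t\<bar> < e \<Longrightarrow> ((\<lambda>t. g (a + of_real t * k)) has_real_derivative g' t) (at t)"
      "(g' has_real_derivative q) (at 0)"
    using assms(2) unfolding second_deriv_along_def by blast
  show ?thesis
    unfolding second_deriv_along_def
    using f g by (intro exI[of _ "\<lambda>t. f' t + g' t"] exI[of _ "min d e"]) (auto intro!: DERIV_add)
qed

lemma second_deriv_along_scale:
  assumes "second_deriv_along f a k q"
  shows "second_deriv_along (\<lambda>x. c * f x) a k (c * q)"
proof -
  obtain g d where "0 < d"
      "\<And>t. \<bar>t\<bar> < d \<Longrightarrow> ((\<lambda>t. f (a + of_real t * k)) has_real_derivative g t) (at t)"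
      "(g has_real_derivative q) (at 0)"
    using assms unfolding second_deriv_along_def by blast
  then show ?thesis
    unfolding second_deriv_along_def
    by (intro exI[of _ "\<lambda>t. c * g t"] exI[of _ d]) (auto intro!: DERIV_cmult)
qed

lemma laplacian_nonneg_at_add:
  assumes "laplacian_nonneg_at f a" "laplacian_nonneg_at g a"
  shows "laplacian_nonneg_at (\<lambda>x. f x + g x) a"
proof -
  obtain p where p: "\<And>k. second_deriv_along f a k (p k)" "\<And>k. 0 \<le> p k + p (\<i> * k)"
    using assms(1) unfolding laplacian_nonneg_at_def by blast
  obtain q where q: "\<And>k. second_deriv_along g a k (q k)" "\<And>k. 0 \<le> q k + q (\<i> * k)"
    using assms(2) unfolding laplacian_nonneg_at_def by blast
  have "0 \<le> (p k + q k) + (p (\<i> * k) + q (\<i> * k))" for k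
    using p(2)[of k] q(2)[of k] by linarith
  then show ?thesis
    unfolding laplacian_nonneg_at_def
    by (intro exI[of _ "\<lambda>k. p k + q k"] allI conjI second_deriv_along_add p q)
qed

lemma laplacian_nonneg_at_sum:
  "finite I \<Longrightarrow> (\<And>i. i \<in> I \<Longrightarrow> laplacian_nonneg_at (f i) a) \<Longrightarrow>
    laplacian_nonneg_at (\<lambda>x. \<Sum>i\<in>I. f i x) a"
proof (induction I rule: finite_induct)
  case empty
  show ?case
    unfolding laplacian_nonneg_at_def second_deriv_along_def
    by (intro exI[of _ "\<lambda>_. 0"] allI conjI exI[of _ 1]) auto
qed (simp add: laplacian_nonneg_at_add)

lemma laplacian_nonneg_at_rotate:
  assumes "laplacian_nonneg_at f (w * a)"
  shows "laplacian_nonneg_at (\<lambda>x. f (w * x)) a"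
proof -
  obtain q where q: "\<And>k. second_deriv_along f (w * a) k (q k)" "\<And>k. 0 \<le> q k + q (\<i> * k)"
    using assms unfolding laplacian_nonneg_at_def by blast
  have "second_deriv_along (\<lambda>x. f (w * x)) a k (q (w * k))" for k
  proof -
    have "w * a + of_real t * (w * k) = w * (a + of_real t * k)" for t
      by (simp add: distrib_left mult.left_commute)
    then show ?thesis
      using q(1)[of "w * k"] unfolding second_deriv_along_def by simp
  qed
  moreover have "0 \<le> q (w * k) + q (w * (\<i> * k))" for k
    using q(2)[of "w * k"] by (simp add: mult.left_commute)
  ultimately show ?thesis
    unfolding laplacian_nonneg_at_def by (intro exI[of _ "\<lambda>k. q (w * k)"] allI conjI)
qed

lemma second_deriv_along_norm_square:
  "second_deriv_along (\<lambda>x. c * (cmod x)\<^sup>2) a k (2 * c * (cmod k)\<^sup>2)"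
proof -
  have eq: "(cmod (a + of_real t * k))\<^sup>2 = (cmod a)\<^sup>2 + 2 * t * inner a k + t\<^sup>2 * (cmod k)\<^sup>2" for t
    unfolding cmod_power2 by (simp add: inner_complex_def power2_eq_square algebra_simps)
  show ?thesis
    unfolding second_deriv_along_def eq
    by (intro exI[of _ "\<lambda>t. c * (2 * inner a k + 2 * t * (cmod k)\<^sup>2)"] exI[of _ 1])
      (auto intro!: derivative_eq_intros)
qed

text \<open>
  A positive second derivative at a critical point makes the function strictly increasing just to
  the right of it.
\<close>

lemma second_deriv_along_local_max:
  assumes q: "second_deriv_along f a k q" and "0 < e"
    and le: "\<And>x. x \<in> ball a e \<Longrightarrow> f x \<le> f a"
  shows "q \<le> 0"
proof (rule ccontr)
  assume "\<not> q \<le> 0"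
  then have "0 < q" by simp
  define G where "G = (\<lambda>t::real. f (a + of_real t * k))"
  obtain g d where g: "0 < d" "\<And>t. \<bar>t\<bar> < d \<Longrightarrow> (G has_real_derivative g t) (at t)"
      "(g has_real_derivative q) (at 0)"
    using q unfolding second_deriv_along_def G_def by blast
  define r where "r = e / (cmod k + 1)"
  have "0 < r" using \<open>0 < e\<close> by (simp add: r_def add_nonneg_pos)
  have near: "G t \<le> G 0" if "\<bar>t\<bar> < r" for t
  proof -
    have "\<bar>t\<bar> * cmod k \<le> \<bar>t\<bar> * (cmod k + 1)" by (intro mult_left_mono) auto
    also have "\<dots> < e" using that by (simp add: r_def pos_less_divide_eq add_nonneg_pos)
    finally have "a + of_real t * k \<in> ball a e" by (simp add: dist_norm norm_mult)
    then show ?thesis using le by (simp add: G_def)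
  qed
  have "g 0 = 0"
    by (rule DERIV_local_max[OF g(2)[of 0] \<open>0 < r\<close>]) (use g(1) near in auto)
  obtain s where s: "0 < s" "\<And>h. 0 < h \<Longrightarrow> h < s \<Longrightarrow> g 0 < g (0 + h)"
    using DERIV_pos_inc_right[OF g(3) \<open>0 < q\<close>] by blast
  define t where "t = min (min d r) s / 2"
  have t: "0 < t" "t < d" "t < r" "t < s"
    using g(1) \<open>0 < r\<close> s(1) by (auto simp: t_def)
  obtain z where z: "0 < z" "z < t" "G t - G 0 = (t - 0) * g z"
    using MVT2[of 0 t G g] t g(2) by force
  have "0 < (t - 0) * g z"
    using s(2)[of z] z t \<open>g 0 = 0\<close> by simp
  then show False using near[of t] t z(3) by simp
qed

text \<open>
  Adding \<open>e\<bar>x\<bar>\<^sup>2\<close> makes the Laplacian positive, which excludes an interior maximum; then let \<open>e\<close>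
  tend to \<open>0\<close>.
\<close>

lemma laplacian_nonneg_max_principle:
  assumes "compact K" "open U" "U \<subseteq> K" and cont: "continuous_on K f"
    and lap: "\<And>a. a \<in> U \<Longrightarrow> laplacian_nonneg_at f a"
    and le: "\<And>x. x \<in> K - U \<Longrightarrow> f x \<le> c" and "z \<in> K"
  shows "f z \<le> c"
proof -
  obtain R where R: "0 < R" "\<And>x. x \<in> K \<Longrightarrow> cmod x \<le> R"
    using compact_imp_bounded[OF \<open>compact K\<close>] by (auto simp: bounded_pos)
  have main: "f z \<le> c + e * R\<^sup>2" if "0 < e" for e
  proof -
    define g where "g = (\<lambda>x. f x + e * (cmod x)\<^sup>2)"
    have "continuous_on K g"
      unfolding g_def by (intro continuous_intros cont)
    then obtain p where p: "p \<in> K" "\<And>x. x \<in> K \<Longrightarrow> g x \<le> g p"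
      using continuous_attains_sup[OF \<open>compact K\<close>] \<open>z \<in> K\<close> by blast
    have "p \<notin> U"
    proof
      assume "p \<in> U"
      then obtain r where r: "0 < r" "ball p r \<subseteq> U"
        using \<open>open U\<close> by (meson openE)
      then have max: "g x \<le> g p" if "x \<in> ball p r" for x
        using that p(2) \<open>U \<subseteq> K\<close> by blast
      obtain q where q: "\<And>k. second_deriv_along f p k (q k)" "\<And>k. 0 \<le> q k + q (\<i> * k)"
        using lap[OF \<open>p \<in> U\<close>] unfolding laplacian_nonneg_at_def by blast
      have "q k + 2 * e * (cmod k)\<^sup>2 \<le> 0" for k
        using second_deriv_along_local_max[OF
            second_deriv_along_add[OF q(1) second_deriv_along_norm_square] \<open>0 < r\<close>] max
        unfolding g_def by blast
      from this[of 1] this[of "\<i>"] show False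
        using q(2)[of 1] \<open>0 < e\<close> by simp
    qed
    then have "f p \<le> c" using le p(1) by blast
    have "f z \<le> g z" using \<open>0 < e\<close> by (simp add: g_def)
    also have "\<dots> \<le> g p" by (rule p(2)[OF \<open>z \<in> K\<close>])
    also have "\<dots> \<le> c + e * R\<^sup>2"
      unfolding g_def using \<open>f p \<le> c\<close> R(2)[OF p(1)] \<open>0 < e\<close>
      by (intro add_mono mult_left_mono power_mono) auto
    finally show ?thesis .
  qed
  show ?thesis
  proof (rule field_le_epsilon)
    fix e :: real assume "0 < e"
    then show "f z \<le> c + e"
      using main[of "e / R\<^sup>2"] R(1) by simp
  qed
qed

lemma left_riemann_sum_le:
  fixes g :: "real \<Rightarrow> real"
  assumes cont: "continuous_on UNIV g" and "0 \<le> h"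
    and near: "\<And>k t. k < n \<Longrightarrow> a + real k * h \<le> t \<Longrightarrow> t \<le> a + real k * h + h \<Longrightarrow>
      g (a + real k * h) \<le> g t + e"
  shows "(\<Sum>k<n. h * g (a + real k * h)) \<le> integral {a..a + real n * h} g + real n * h * e"
  using near
proof (induction n)
  case (Suc n)
  have int: "g integrable_on {x..y}" for x y
    by (intro integrable_continuous_real continuous_on_subset[OF cont]) auto
  let ?b = "a + real n * h"
  have "h * g ?b = integral {?b..?b + h} (\<lambda>_. g ?b)"
    using \<open>0 \<le> h\<close> by simp
  also have "\<dots> \<le> integral {?b..?b + h} (\<lambda>t. g t + e)"
    using Suc.prems by (intro integral_le integrable_add int) auto
  also have "\<dots> = integral {?b..?b + h} g + h * e"
    using \<open>0 \<le> h\<close> by (subst integral_add) (auto intro: int)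
  finally have step: "h * g ?b \<le> integral {?b..?b + h} g + h * e" .
  have "integral {a..?b} g + integral {?b..?b + h} g = integral {a..?b + h} g"
    using \<open>0 \<le> h\<close> by (intro Henstock_Kurzweil_Integration.integral_combine int) auto
  moreover have "(\<Sum>k<n. h * g (a + real k * h)) \<le> integral {a..?b} g + real n * h * e"
    by (intro Suc.IH Suc.prems) auto
  ultimately show ?case using step by (simp add: algebra_simps)
qed simp

lemma integral_period_shift:
  fixes g :: "real \<Rightarrow> real"
  assumes cont: "continuous_on UNIV g" and per: "\<And>t. g (t + p) = g t"
    and "0 \<le> a" "a \<le> p"
  shows "integral {a..a + p} g = integral {0..p} g"
proof -
  have int: "g integrable_on {x..y}" for x y
    by (intro integrable_continuous_real continuous_on_subset[OF cont]) auto
  have "integral {a..a + p} g = integral {a..p} g + integral {p..a + p} g"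
    using assms by (intro Henstock_Kurzweil_Integration.integral_combine[symmetric] int) auto
  also have "integral {p..a + p} g = integral {0..a} g"
    using integral_shift_real_ivl[of p p "a + p" g] by (simp add: per)
  also have "integral {a..p} g + integral {0..a} g = integral {0..p} g"
    using assms Henstock_Kurzweil_Integration.integral_combine[of 0 a p g] int by simp
  finally show ?thesis .
qed

text \<open>
  The average of \<open>f\<close> over the rotations by multiples of \<open>2\<pi>/n\<close> again has a nonnegative Laplacian and
  takes the value \<open>f 0\<close> at the centre.  By the maximum principle \<open>f 0\<close> is at most its maximum on the
  unit circle; there it is a Riemann sum of the mean of \<open>f\<close>, and for large \<open>n\<close> it is uniformly close
  to that mean.
\<close>

lemma laplacian_nonneg_mean_value:
  assumes cont: "continuous_on (cball 0 1) f"
    and lap: "\<And>a. a \<in> ball 0 1 \<Longrightarrow> laplacian_nonneg_at f a"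
  shows "2 * pi * f 0 \<le> integral {0..2 * pi} (\<lambda>\<theta>. f (cis \<theta>))"
proof -
  define g where "g = (\<lambda>\<theta>. f (cis \<theta>))"
  have g: "continuous_on UNIV g"
    unfolding g_def by (intro continuous_on_compose2[OF cont] continuous_intros) auto
  have per: "g (t + 2 * pi) = g t" for t
    by (simp add: g_def cis.ctr)
  have "2 * pi * f 0 \<le> integral {0..2 * pi} g + e" if "0 < e" for e
  proof -
    define e' where "e' = e / (2 * pi)"
    have "0 < e'" using that by (simp add: e'_def)
    have "uniformly_continuous_on {0..4 * pi} g"
      by (intro compact_uniformly_continuous continuous_on_subset[OF g]) auto
    then obtain d where d: "0 < d" "\<And>s t. s \<in> {0..4 * pi} \<Longrightarrow> t \<in> {0..4 * pi} \<Longrightarrow> dist t s < d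
        \<Longrightarrow> dist (g t) (g s) < e'"
      using \<open>0 < e'\<close> unfolding uniformly_continuous_on_def by metis
    obtain n where n: "2 * pi / d < real n" using reals_Archimedean2 by blast
    have "0 < n" using n d(1) by (cases "n = 0") (auto simp: divide_less_0_iff)
    define h where "h = 2 * pi / real n"
    have h: "0 < h" "h < d" "real n * h = 2 * pi"
      using n d(1) \<open>0 < n\<close> by (auto simp: h_def field_simps)
    define F where "F = (\<lambda>x. \<Sum>k<n. f (cis (real k * h) * x))"
    have "F 0 \<le> (integral {0..2 * pi} g + e) / h"
    proof (rule laplacian_nonneg_max_principle[where K = "cball 0 1" and U = "ball 0 1" and f = F])
      show "continuous_on (cball 0 1) F"
        unfolding F_def
        by (intro continuous_on_sum continuous_on_compose2[OF cont] continuous_intros)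
          (auto simp: norm_mult)
      show "laplacian_nonneg_at F a" if "a \<in> ball 0 1" for a
        unfolding F_def
        by (intro laplacian_nonneg_at_sum laplacian_nonneg_at_rotate lap)
          (use that in \<open>auto simp: norm_mult\<close>)
      show "F x \<le> (integral {0..2 * pi} g + e) / h" if "x \<in> cball 0 1 - ball 0 1" for x
      proof -
        have "cmod x = 1" using that by simp
        define a where "a = Arg2pi x"
        have a: "0 \<le> a" "a \<le> 2 * pi" "x = cis a"
          using Arg2pi[of x] \<open>cmod x = 1\<close> complex_norm_eq_1_exp[of x]
          by (auto simp: a_def cis_conv_exp)
        have "h * F x = (\<Sum>k<n. h * g (a + real k * h))"
          by (simp add: F_def g_def a(3) sum_distrib_left cis_mult add.commute)
        also have "\<dots> \<le> integral {a..a + real n * h} g + real n * h * e'"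
        proof (rule left_riemann_sum_le[OF g])
          fix k t assume k: "k < n" and t: "a + real k * h \<le> t" "t \<le> a + real k * h + h"
          have "real k * h + h \<le> 2 * pi"
          proof -
            have "(real k + 1) * h \<le> real n * h"
              using k h by (intro mult_right_mono) auto
            then show ?thesis using h by (simp add: algebra_simps)
          qed
          moreover have "0 \<le> real k * h" using h by simp
          ultimately have "a + real k * h \<in> {0..4 * pi}" "t \<in> {0..4 * pi}"
              "dist t (a + real k * h) < d"
            using t a h unfolding atLeastAtMost_iff dist_real_def by linarith+
          then have "dist (g (a + real k * h)) (g t) < e'"
            by (metis d(2) dist_commute)
          then show "g (a + real k * h) \<le> g t + e'"
            by (simp add: dist_real_def)
        qed (use h in simp)
        also have "\<dots> = integral {0..2 * pi} g + e"
          using integral_period_shift[OF g per a(1,2)] by (simp add: h e'_def)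
        finally show ?thesis using h by (simp add: pos_le_divide_eq mult.commute)
      qed
    qed auto
    then have "h * F 0 \<le> integral {0..2 * pi} g + e"
      using h by (simp add: pos_le_divide_eq mult.commute)
    moreover have "h * F 0 = 2 * pi * f 0"
    proof -
      have "h * F 0 = (real n * h) * f 0" by (simp add: F_def)
      then show ?thesis by (simp only: h(3))
    qed
    ultimately show ?thesis by simp
  qed
  then show ?thesis
    unfolding g_def by (rule field_le_epsilon)
qed

text \<open>
  For a function that is real and continuous on the circle, the positive and negative parts have
  finite integrals and the extended-real mean is the ordinary one.
\<close>

lemma circle_mean_real:
  assumes cont: "continuous_on {0..2 * pi} (\<lambda>\<theta>. f (z + scaleC (cis \<theta>) h))"
  shows "circle_mean (\<lambda>x. ereal (f x)) z h
    = ereal (1 / (2 * pi) * integral {0..2 * pi} (\<lambda>\<theta>. f (z + scaleC (cis \<theta>) h)))"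
proof -
  define g where "g = (\<lambda>\<theta>. f (z + scaleC (cis \<theta>) h))"
  define G where "G = (\<lambda>\<theta>. indicator {0..2 * pi} \<theta> *\<^sub>R g \<theta>)"
  have set_int: "set_integrable lborel {0..2 * pi} g"
    using cont unfolding g_def by (intro borel_integrable_atLeastAtMost')
  then have G: "integrable lborel G" by (simp add: set_integrable_def G_def)
  define P N where "P = (\<integral>\<^sup>+\<theta>. ennreal (G \<theta>) \<partial>lborel)" and "N = (\<integral>\<^sup>+\<theta>. ennreal (- G \<theta>) \<partial>lborel)"
  have fin: "P \<noteq> \<infinity>" "N \<noteq> \<infinity>"
    using G by (auto simp: real_integrable_def P_def N_def)
  have fin_ereal: "enn2ereal x = ereal (enn2real x)" if "x \<noteq> \<infinity>" for x
    using that by (cases x) auto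
  have "enn2real P - enn2real N = integral\<^sup>L lborel G"
    by (simp add: real_lebesgue_integral_def[OF G] P_def N_def)
  also have "\<dots> = integral {0..2 * pi} g"
    using set_borel_integral_eq_integral(2)[OF set_int] by (simp add: set_lebesgue_integral_def G_def)
  finally have I: "enn2real P - enn2real N = integral {0..2 * pi} g" .
  have "(\<integral>\<^sup>+\<theta>\<in>{0..2*pi}. e2ennreal (ereal (g \<theta>)) \<partial>lborel) = P"
    unfolding P_def by (intro nn_integral_cong) (simp add: G_def indicator_def)
  moreover have "(\<integral>\<^sup>+\<theta>\<in>{0..2*pi}. e2ennreal (- ereal (g \<theta>)) \<partial>lborel) = N"
    unfolding N_def by (intro nn_integral_cong) (simp add: G_def indicator_def)
  ultimately show ?thesis
    using I unfolding circle_mean_def g_def by (simp add: fin_ereal[OF fin(1)] fin_ereal[OF fin(2)])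
qed

section \<open>Second derivatives and the Levi operator\<close>

lemma fderiv_has_derivative:
  assumes "f differentiable (at a)"
  shows "(f has_derivative blinfun_apply (fderiv f a)) (at a)"
proof -
  obtain F where F: "(f has_derivative F) (at a)"
    using assms by (auto simp: differentiable_def)
  then have D: "(f has_derivative blinfun_apply (Blinfun F)) (at a)"
    by (simp add: bounded_linear_Blinfun_apply has_derivative_bounded_linear)
  show ?thesis
    unfolding fderiv_def
  proof (rule theI)
    show "E = Blinfun F" if "(f has_derivative blinfun_apply E) (at a)" for E
      using has_derivative_unique[OF that D] by (simp add: blinfun_apply_inject)
  qed (rule D)
qed

text \<open>
  The mean value theorem for \<open>x \<mapsto> f (a + xs + t) - f (a + xs)\<close> expresses the second difference
  through \<open>D\<close> at two points, where \<open>D\<close> is replaced by its linearization at \<open>a\<close>.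
\<close>

lemma second_difference_estimate:
  fixes f :: "'a::real_normed_vector \<Rightarrow> real" and D :: "'a \<Rightarrow> 'a \<Rightarrow>\<^sub>L real"
  assumes f: "\<And>x. x \<in> ball a r \<Longrightarrow> (f has_derivative blinfun_apply (D x)) (at x)"
    and D': "\<And>x. x \<in> ball a r \<Longrightarrow> norm (D x - D a - blinfun_apply D' (x - a)) \<le> \<eta> * norm (x - a)"
    and st: "norm s + norm t < r" and "0 \<le> \<eta>"
  shows "\<bar>f (a + s + t) - f (a + s) - f (a + t) + f a - blinfun_apply (blinfun_apply D' t) s\<bar>
    \<le> 2 * \<eta> * (norm s + norm t)\<^sup>2"
proof -
  have in_ball: "a + x *\<^sub>R s + y *\<^sub>R t \<in> ball a r"
      "norm (x *\<^sub>R s + y *\<^sub>R t) \<le> norm s + norm t" if "0 \<le> x" "x \<le> 1" "0 \<le> y" "y \<le> 1" for x y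
  proof -
    have "norm (x *\<^sub>R s + y *\<^sub>R t) \<le> x * norm s + y * norm t"
      using norm_triangle_ineq[of "x *\<^sub>R s" "y *\<^sub>R t"] that by simp
    also have "\<dots> \<le> norm s + norm t"
      using that by (intro add_mono mult_left_le_one_le) auto
    finally show *: "norm (x *\<^sub>R s + y *\<^sub>R t) \<le> norm s + norm t" .
    then show "a + x *\<^sub>R s + y *\<^sub>R t \<in> ball a r"
      using st norm_minus_cancel[of "x *\<^sub>R s + y *\<^sub>R t"] by (simp add: dist_norm add.assoc)
  qed
  define G where "G = (\<lambda>x. f (a + x *\<^sub>R s + 1 *\<^sub>R t) - f (a + x *\<^sub>R s + 0 *\<^sub>R t))"
  have deriv: "((\<lambda>x. f (a + x *\<^sub>R s + y *\<^sub>R t)) has_real_derivative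
      blinfun_apply (D (a + x *\<^sub>R s + y *\<^sub>R t)) s) (at x)"
    if "0 \<le> x" "x \<le> 1" "0 \<le> y" "y \<le> 1" for x y
  proof -
    have "((\<lambda>x. a + x *\<^sub>R s + y *\<^sub>R t) has_derivative (\<lambda>h. h *\<^sub>R s)) (at x)"
      by (auto intro!: derivative_eq_intros)
    from has_derivative_compose[OF this f[OF in_ball(1)[OF that]]]
    show ?thesis
      unfolding has_field_derivative_def
      by (simp add: blinfun.scaleR_right mult_commute_abs)
  qed
  have G: "(G has_real_derivative (blinfun_apply (D (a + x *\<^sub>R s + 1 *\<^sub>R t)) s
      - blinfun_apply (D (a + x *\<^sub>R s + 0 *\<^sub>R t)) s)) (at x)" if "0 \<le> x" "x \<le> 1" for x
    unfolding G_def by (intro DERIV_diff deriv that) auto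
  obtain z where z: "0 < z" "z < 1" and Gz: "G 1 - G 0 = (1 - 0) *
      (blinfun_apply (D (a + z *\<^sub>R s + 1 *\<^sub>R t)) s - blinfun_apply (D (a + z *\<^sub>R s + 0 *\<^sub>R t)) s)"
    using MVT2[OF zero_less_one G] by blast
  define P Q where "P = a + z *\<^sub>R s + 1 *\<^sub>R t" and "Q = a + z *\<^sub>R s + 0 *\<^sub>R t"
  have P: "P \<in> ball a r" "norm (P - a) \<le> norm s + norm t"
    using in_ball[of z 1] z by (simp_all add: P_def add.assoc)
  have Q: "Q \<in> ball a r" "norm (Q - a) \<le> norm s + norm t"
    using in_ball[of z 0] z by (simp_all add: Q_def)
  have PQ: "blinfun_apply D' (P - a) - blinfun_apply D' (Q - a) = blinfun_apply D' t"
    by (simp add: P_def Q_def flip: blinfun.diff_right)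
  have "norm (D P - D Q - D' t) = norm ((D P - D a - D' (P - a)) - (D Q - D a - D' (Q - a)))"
    by (simp add: algebra_simps flip: PQ)
  also have "\<dots> \<le> \<eta> * norm (P - a) + \<eta> * norm (Q - a)"
    using norm_triangle_ineq4 D'[OF P(1)] D'[OF Q(1)] by (meson add_mono order_trans)
  also have "\<dots> \<le> \<eta> * (norm s + norm t) + \<eta> * (norm s + norm t)"
    using P(2) Q(2) \<open>0 \<le> \<eta>\<close> by (intro add_mono mult_left_mono)
  finally have est: "norm (D P - D Q - D' t) \<le> 2 * \<eta> * (norm s + norm t)" by simp
  have "f (a + s + t) - f (a + s) - f (a + t) + f a - D' t s = (D P - D Q - D' t) s"
    using Gz unfolding G_def P_def[symmetric] Q_def[symmetric] by (simp add: blinfun.diff_left)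
  also have "\<bar>\<dots>\<bar> \<le> norm (D P - D Q - D' t) * norm s"
    using norm_blinfun[of "D P - D Q - D' t" s] by simp
  also have "\<dots> \<le> (2 * \<eta> * (norm s + norm t)) * (norm s + norm t)"
    using est by (intro mult_mono) (auto intro: mult_nonneg_nonneg \<open>0 \<le> \<eta>\<close>)
  finally show ?thesis by (simp add: power2_eq_square mult.assoc)
qed

text \<open>
  The second difference is symmetric in \<open>s\<close> and \<open>t\<close> and approximates, for small multiples of them,
  both \<open>D' t s\<close> and \<open>D' s t\<close>.
\<close>

lemma second_derivative_symmetric:
  fixes f :: "'a::real_normed_vector \<Rightarrow> real" and D :: "'a \<Rightarrow> 'a \<Rightarrow>\<^sub>L real"
  assumes "open S" "a \<in> S"
    and f: "\<And>x. x \<in> S \<Longrightarrow> (f has_derivative blinfun_apply (D x)) (at x)"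
    and D': "(D has_derivative blinfun_apply D') (at a)"
  shows "blinfun_apply (blinfun_apply D' s) t = blinfun_apply (blinfun_apply D' t) s"
proof -
  define B where "B = (\<lambda>s t. blinfun_apply (blinfun_apply D' s) t)"
  define C where "C = norm s + norm t"
  have bound: "\<bar>B s t - B t s\<bar> \<le> 4 * \<eta> * C\<^sup>2" if "0 < \<eta>" for \<eta>
  proof -
    obtain d where d: "0 < d" "\<And>y. norm (y - a) < d \<Longrightarrow>
        norm (D y - D a - D' (y - a)) \<le> \<eta> * norm (y - a)"
      using D' \<open>0 < \<eta>\<close> unfolding has_derivative_at_alt by blast
    obtain r0 where r0: "0 < r0" "ball a r0 \<subseteq> S" using assms(1,2) by (meson openE)
    define r where "r = min d r0"
    define \<epsilon> where "\<epsilon> = r / (C + 1)"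
    have "0 \<le> C" by (simp add: C_def)
    have "0 < r" using d r0 by (simp add: r_def)
    have \<epsilon>: "0 < \<epsilon>" "\<epsilon> * C < r"
      using \<open>0 < r\<close> \<open>0 \<le> C\<close> by (auto simp: \<epsilon>_def field_simps)
    have small: "norm (\<epsilon> *\<^sub>R s) + norm (\<epsilon> *\<^sub>R t) = \<epsilon> * C"
      using \<epsilon> by (simp add: C_def distrib_left)
    have fr: "(f has_derivative blinfun_apply (D x)) (at x)" if "x \<in> ball a r" for x
      using that r0 f by (auto simp: r_def)
    have Dr: "norm (D x - D a - D' (x - a)) \<le> \<eta> * norm (x - a)" if "x \<in> ball a r" for x
      using that d(2)[of x] by (simp add: r_def dist_norm norm_minus_commute)
    have est: "\<bar>f (a + s + t) - f (a + s) - f (a + t) + f a - B t s\<bar>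
        \<le> 2 * \<eta> * (norm s + norm t)\<^sup>2" if "norm s + norm t < r" for s t
      unfolding B_def
      by (rule second_difference_estimate[where D = D and r = r, OF fr Dr that])
        (use \<open>0 < \<eta>\<close> in auto)
    have 1: "\<bar>f (a + \<epsilon> *\<^sub>R s + \<epsilon> *\<^sub>R t) - f (a + \<epsilon> *\<^sub>R s) - f (a + \<epsilon> *\<^sub>R t) + f a
        - B (\<epsilon> *\<^sub>R t) (\<epsilon> *\<^sub>R s)\<bar> \<le> 2 * \<eta> * (\<epsilon> * C)\<^sup>2"
      using est[of "\<epsilon> *\<^sub>R s" "\<epsilon> *\<^sub>R t"] \<epsilon>(2) by (simp only: small)
    have 2: "\<bar>f (a + \<epsilon> *\<^sub>R t + \<epsilon> *\<^sub>R s) - f (a + \<epsilon> *\<^sub>R t) - f (a + \<epsilon> *\<^sub>R s) + f a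
        - B (\<epsilon> *\<^sub>R s) (\<epsilon> *\<^sub>R t)\<bar> \<le> 2 * \<eta> * (\<epsilon> * C)\<^sup>2"
      using est[of "\<epsilon> *\<^sub>R t" "\<epsilon> *\<^sub>R s"] \<epsilon>(2)
      by (simp only: small add.commute[of "norm (\<epsilon> *\<^sub>R t)"])
    have comm: "a + \<epsilon> *\<^sub>R t + \<epsilon> *\<^sub>R s = a + \<epsilon> *\<^sub>R s + \<epsilon> *\<^sub>R t" by (simp add: add_ac)
    have "\<bar>B (\<epsilon> *\<^sub>R s) (\<epsilon> *\<^sub>R t) - B (\<epsilon> *\<^sub>R t) (\<epsilon> *\<^sub>R s)\<bar> \<le> 4 * \<eta> * (\<epsilon> * C)\<^sup>2"
      using 1 2 unfolding comm by linarith
    moreover have "B (\<epsilon> *\<^sub>R s) (\<epsilon> *\<^sub>R t) - B (\<epsilon> *\<^sub>R t) (\<epsilon> *\<^sub>R s) = \<epsilon>\<^sup>2 * (B s t - B t s)"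
      by (simp add: B_def blinfun.scaleR_left blinfun.scaleR_right power2_eq_square algebra_simps)
    ultimately have "\<epsilon>\<^sup>2 * \<bar>B s t - B t s\<bar> \<le> \<epsilon>\<^sup>2 * (4 * \<eta> * C\<^sup>2)"
      by (simp add: abs_mult power_mult_distrib mult.left_commute mult.assoc)
    then show ?thesis using \<epsilon>(1) by simp
  qed
  have "\<bar>B s t - B t s\<bar> \<le> 0"
  proof (rule field_le_epsilon)
    fix e :: real assume "0 < e"
    define k where "k = C\<^sup>2 + 1"
    have k: "0 < k" "C\<^sup>2 \<le> k" by (auto simp: k_def add_nonneg_pos)
    have "\<bar>B s t - B t s\<bar> \<le> 4 * (e / (4 * k)) * C\<^sup>2"
      using \<open>0 < e\<close> k by (intro bound) simp
    also have "\<dots> \<le> e"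
      using \<open>0 < e\<close> k by (simp add: field_simps)
    finally show "\<bar>B s t - B t s\<bar> \<le> 0 + e" by simp
  qed
  then show ?thesis by (simp add: B_def)
qed

lemma norm_scaleC: "norm (scaleC c x) = cmod c * norm (x::'a::complex_inner_space)"
proof -
  have "cinner x (scaleC c x) = cnj (c * cinner x x)"
    by (subst cinner_commute) (simp only: cinner_scaleC_left)
  then have "cinner (scaleC c x) (scaleC c x) = (c * cnj c) * cnj (cinner x x)"
    by (simp add: cinner_scaleC_left)
  then have "(norm (scaleC c x))\<^sup>2 = (cmod c)\<^sup>2 * (norm x)\<^sup>2"
  proof -
    assume "cinner (scaleC c x) (scaleC c x) = (c * cnj c) * cnj (cinner x x)"
    also have "c * cnj c = complex_of_real ((cmod c)\<^sup>2)"
      by (rule complex_norm_square[symmetric])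
    finally have "Re (cinner (scaleC c x) (scaleC c x)) = (cmod c)\<^sup>2 * Re (cinner x x)" by simp
    then show ?thesis by (simp add: power2_norm_eq_inner[of x] power2_norm_eq_inner[of "scaleC c x"]
        inner_eq_Re_cinner)
  qed
  then show ?thesis
    by (metis norm_ge_zero norm_mult power2_eq_imp_eq power_mult_distrib mult_nonneg_nonneg)
qed

lemma scaleC_scaleR_right: "scaleC c (r *\<^sub>R x) = r *\<^sub>R scaleC c (x::'a::complex_inner_space)"
  by (simp add: scaleR_eq_scaleC scaleC_scaleC mult.commute)

lemma scaleC_conv_scaleR:
  "scaleC c x = Re c *\<^sub>R x + Im c *\<^sub>R scaleC \<i> (x::'a::complex_inner_space)"
proof -
  have "scaleC c x = scaleC (of_real (Re c) + of_real (Im c) * \<i>) x"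
    by (metis complex_eq mult.commute)
  also have "\<dots> = Re c *\<^sub>R x + Im c *\<^sub>R scaleC \<i> x"
    by (simp add: scaleC_add_left scaleR_eq_scaleC scaleC_scaleC)
  finally show ?thesis .
qed

lemma scaleC_i_i [simp]: "scaleC \<i> (scaleC \<i> x) = - (x::'a::complex_inner_space)"
  using scaleR_eq_scaleC[of "-1" x] by (simp add: scaleC_scaleC)

lemma bounded_linear_scaleC_left: "bounded_linear (\<lambda>c. scaleC c (x::'a::complex_inner_space))"
  by (rule bounded_linear_intro[where K = "norm x"])
    (simp_all add: scaleC_add_left scaleR_conv_of_real norm_scaleC scaleR_eq_scaleC scaleC_scaleC)

text \<open>
  The representing vector is the minimizer of \<open>J(y) = \<parallel>y\<parallel>\<^sup>2/2 - f(y)\<close>.  Minimizing sequences are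
  Cauchy by the parallelogram law.
\<close>

lemma riesz_representation:
  fixes f :: "'a::{real_inner,complete_space} \<Rightarrow> real"
  assumes "bounded_linear f"
  shows "\<exists>y. \<forall>x. f x = inner y x"
proof -
  interpret f: bounded_linear f by fact
  define J where "J = (\<lambda>y. (norm y)\<^sup>2 / 2 - f y)"
  obtain K where K: "\<And>x. \<bar>f x\<bar> \<le> norm x * K" using f.bounded by (auto simp: real_norm_def)
  have low: "- (K\<^sup>2 / 2) \<le> J y" for y
  proof -
    have "0 \<le> (norm y - K)\<^sup>2" by simp
    then show ?thesis using K[of y] by (simp add: J_def power2_diff)
  qed
  define I where "I = Inf (range J)"
  have bdd: "bdd_below (range J)" using low by (auto intro!: bdd_belowI)
  have I: "I \<le> J y" for y unfolding I_def by (intro cInf_lower bdd) auto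
  have "\<exists>y. J y < I + 1 / real (Suc n)" for n
    using cInf_lessD[of "range J" "I + 1 / real (Suc n)"] by (auto simp: I_def)
  then obtain Y where Y: "\<And>n. J (Y n) < I + 1 / real (Suc n)" by metis
  have par: "(norm (x - y))\<^sup>2 \<le> 4 * (J x - I) + 4 * (J y - I)" for x y
  proof -
    have "(norm (x - y))\<^sup>2 = 4 * J x + 4 * J y - 8 * J ((1/2) *\<^sub>R (x + y))"
      by (simp add: J_def f.scaleR f.add power2_norm_eq_inner inner_add_left inner_add_right
          inner_diff_left inner_diff_right inner_commute algebra_simps power_divide)
    then show ?thesis using I[of "(1/2) *\<^sub>R (x + y)"] by simp
  qed
  have "Cauchy Y"
  proof (rule metric_CauchyI)
    fix e :: real assume "0 < e"
    then obtain N where N: "inverse (real (Suc N)) < e\<^sup>2 / 8"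
      using reals_Archimedean[of "e\<^sup>2 / 8"] by auto
    have "dist (Y i) (Y j) < e" if "N \<le> i" "N \<le> j" for i j
    proof -
      have small: "J (Y k) - I < e\<^sup>2 / 8" if "N \<le> k" for k
      proof -
        have "1 / real (Suc k) \<le> inverse (real (Suc N))" using that by (simp add: divide_simps)
        then show ?thesis using Y[of k] N by linarith
      qed
      have "(norm (Y i - Y j))\<^sup>2 < e\<^sup>2"
      proof -
        have arith: "x < E" if "x \<le> 4 * p + 4 * q" "p < E / 8" "q < E / 8" for x p q E :: real
          using that by linarith
        show ?thesis by (rule arith[OF par small[OF that(1)] small[OF that(2)]])
      qed
      then show ?thesis
        unfolding dist_norm by (rule power2_less_imp_less) (use \<open>0 < e\<close> in simp)
    qed
    then show "\<exists>M. \<forall>m\<ge>M. \<forall>n\<ge>M. dist (Y m) (Y n) < e" by blast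
  qed
  then obtain y where y: "Y \<longlonglongrightarrow> y" by (auto simp: Cauchy_convergent_iff convergent_def)
  have "(\<lambda>n. J (Y n)) \<longlonglongrightarrow> J y"
    unfolding J_def by (intro tendsto_intros y f.tendsto) simp
  moreover have "(\<lambda>n. I + 1 / real (Suc n)) \<longlonglongrightarrow> I + 0"
    by (intro tendsto_intros) (rule LIMSEQ_Suc, rule lim_1_over_n)
  ultimately have "J y \<le> I + 0"
    by (rule LIMSEQ_le) (use Y less_imp_le in blast)
  then have min: "J y \<le> J x" for x using I[of x] by simp
  have "f x = inner y x" for x
  proof -
    define g where "g = (\<lambda>t. J (y + t *\<^sub>R x))"
    have g: "g = (\<lambda>t. J y + t * (inner y x - f x) + t\<^sup>2 * (norm x)\<^sup>2 / 2)"
    proof (rule ext)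
      fix t
      have "(norm (y + t *\<^sub>R x))\<^sup>2 = (norm y)\<^sup>2 + 2 * t * inner y x + t\<^sup>2 * (norm x)\<^sup>2"
        unfolding power2_norm_eq_inner
        by (simp add: inner_add_left inner_add_right inner_commute power2_eq_square algebra_simps)
      then show "g t = J y + t * (inner y x - f x) + t\<^sup>2 * (norm x)\<^sup>2 / 2"
        by (simp add: g_def J_def f.add f.scaleR field_simps)
    qed
    have "(g has_real_derivative (inner y x - f x)) (at 0)"
      unfolding g by (auto intro!: derivative_eq_intros)
    moreover have "g 0 \<le> g t" for t using min by (simp add: g_def)
    ultimately have "inner y x - f x = 0"
      by (intro DERIV_local_min[of g _ 0 1]) auto
    then show ?thesis by simp
  qed
  then show ?thesis by blast
qed

lemma bilinear_form_representation:
  fixes b :: "'a::{real_inner,complete_space} \<Rightarrow> 'a \<Rightarrow> real"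
  assumes "bounded_bilinear b"
  shows "\<exists>T. \<forall>s t. inner (blinfun_apply T s) t = b s t"
proof -
  interpret b: bounded_bilinear b by fact
  obtain F where F: "\<And>s t. b s t = inner (F s) t"
    using riesz_representation[OF b.bounded_linear_right] by metis
  have eqI: "x = y" if "\<And>t. inner x t = inner y t" for x y :: 'a
    using that by (metis inner_commute vector_eq_rdot)
  obtain K where K: "\<And>s t. norm (b s t) \<le> norm s * norm t * K" "0 \<le> K"
    using b.nonneg_bounded by blast
  have "bounded_linear F"
  proof (rule bounded_linear_intro[where K = K])
    show "F (x + y) = F x + F y" for x y
      by (rule eqI) (simp add: inner_add_left b.add_left flip: F)
    show "F (r *\<^sub>R x) = r *\<^sub>R F x" for r x
      by (rule eqI) (simp add: b.scaleR_left flip: F)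
    show "norm (F x) \<le> norm x * K" for x
    proof (cases "F x = 0")
      case False
      have "norm (F x) * norm (F x) = b x (F x)"
        by (simp add: F flip: power2_norm_eq_inner power2_eq_square)
      also have "\<dots> \<le> norm x * norm (F x) * K" using K(1)[of x "F x"] by simp
      finally have "norm (F x) * norm (F x) \<le> norm (F x) * (norm x * K)" by (simp add: ac_simps)
      then show ?thesis using False by simp
    qed (simp add: K)
  qed
  then show ?thesis
    by (intro exI[of _ "Blinfun F"]) (simp add: bounded_linear_Blinfun_apply F)
qed

lemma inner_scaleC_i_right: "inner x (scaleC \<i> y) = Im (cinner x (y::'a::complex_inner_space))"
proof -
  have "cinner x (scaleC \<i> y) = cnj (\<i> * cinner y x)"
    by (metis cinner_commute cinner_scaleC_left)
  also have "\<dots> = - \<i> * cinner x y"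
    by (simp add: cinner_commute[of x y])
  finally show ?thesis by (simp add: inner_eq_Re_cinner)
qed

text \<open>
  The real part of the Levi form is a bounded real bilinear form, represented by a real linear
  operator \<open>T\<close>.  The imaginary parts agree as well because \<open>Im \<langle>Ts,t\<rangle> = Re \<langle>Ts,it\<rangle>\<close> and the Levi form
  obeys the same rule.
\<close>

lemma levi_op_representation:
  fixes u :: "'a::complex_hilbert_space \<Rightarrow> real"
  shows "cinner (blinfun_apply (levi_op u a) s) t = levi_form u a s t"
proof -
  define b where "b = (\<lambda>s t. (D2 u a s t + D2 u a (scaleC \<i> s) (scaleC \<i> t)) / 4)"
  have "bounded_bilinear b"
    unfolding b_def
  proof (rule bounded_bilinear.intro)
    let ?K = "norm (fderiv (fderiv u) a)"
    have D: "\<bar>D2 u a s t\<bar> \<le> norm s * norm t * ?K" for s t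
    proof -
      have "\<bar>D2 u a s t\<bar> \<le> norm (blinfun_apply (fderiv (fderiv u) a) s) * norm t"
        unfolding D2_def using norm_blinfun[of "blinfun_apply (fderiv (fderiv u) a) s" t] by simp
      also have "\<dots> \<le> ?K * norm s * norm t"
        by (intro mult_right_mono norm_blinfun) simp
      finally show ?thesis by (simp add: ac_simps)
    qed
    have "norm ((D2 u a s t + D2 u a (scaleC \<i> s) (scaleC \<i> t)) / 4) \<le> norm s * norm t * ?K" for s t
      using D[of s t] D[of "scaleC \<i> s" "scaleC \<i> t"] by (simp add: norm_scaleC)
    then show "\<exists>K. \<forall>s t. norm ((D2 u a s t + D2 u a (scaleC \<i> s) (scaleC \<i> t)) / 4) \<le> norm s * norm t * K"
      by blast
  qed (simp_all add: D2_def blinfun.bilinear_simps scaleC_add_right scaleC_scaleR_right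
      field_simps)
  then obtain T where T: "\<And>s t. inner (blinfun_apply T s) t = b s t"
    using bilinear_form_representation by blast
  have T_levi: "cinner (blinfun_apply T s) t = levi_form u a s t" for s t
  proof (rule complex_eqI)
    show "Re (cinner (blinfun_apply T s) t) = Re (levi_form u a s t)"
      using T[of s t] by (simp add: inner_eq_Re_cinner levi_form_def b_def)
    show "Im (cinner (blinfun_apply T s) t) = Im (levi_form u a s t)"
      using T[of s "scaleC \<i> t"] unfolding inner_scaleC_i_right
      by (simp add: levi_form_def b_def D2_def blinfun.minus_right)
  qed
  have "levi_op u a = T"
    unfolding levi_op_def
  proof (rule the_equality)
    show "T' = T" if "\<forall>s t. cinner (blinfun_apply T' s) t = levi_form u a s t" for T'
    proof (rule blinfun_eqI)
      fix s
      have "inner (blinfun_apply T' s) t = inner (blinfun_apply T s) t" for t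
        using that T_levi by (simp add: inner_eq_Re_cinner)
      then show "blinfun_apply T' s = blinfun_apply T s"
        by (metis inner_commute vector_eq_rdot)
    qed
  qed (use T_levi in blast)
  then show ?thesis using T_levi by simp
qed

section \<open>Levi forms of plurisubharmonic functions\<close>

text \<open>
  The interior part of \<^const>\<open>C2_closure\<close>.
\<close>

definition C2_on :: "'a::real_normed_vector set \<Rightarrow> ('a \<Rightarrow> real) \<Rightarrow> bool"
  where "C2_on \<Omega> u \<longleftrightarrow> (\<forall>z\<in>\<Omega>. u differentiable (at z) \<and> fderiv u differentiable (at z))
    \<and> continuous_on \<Omega> (\<lambda>z. fderiv (fderiv u) z)"

lemma C2_closure_imp_C2_on:
  assumes "C2_closure \<Omega> u"
  shows "C2_on \<Omega> u"
proof -
  obtain g where g: "continuous_on (closure \<Omega>) g" "\<And>z. z \<in> \<Omega> \<Longrightarrow> g z = fderiv (fderiv u) z"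
    using assms by (auto simp: C2_closure_def)
  have "continuous_on \<Omega> g" using g(1) closure_subset by (rule continuous_on_subset)
  then have "continuous_on \<Omega> (\<lambda>z. fderiv (fderiv u) z)"
    using g(2) by (simp cong: continuous_on_cong)
  then show ?thesis using assms by (simp add: C2_on_def C2_closure_def)
qed

lemma C2_on_continuous_on:
  assumes "C2_on \<Omega> u"
  shows "continuous_on \<Omega> u"
  using assms
  by (meson C2_on_def continuous_at_imp_continuous_on differentiable_imp_continuous_within)

lemma symmetric_levi_op:
  fixes u :: "'a::complex_hilbert_space \<Rightarrow> real"
  assumes "open \<Omega>" "z \<in> \<Omega>" "C2_on \<Omega> u"
  shows "symmetric_op (levi_op u z)"
proof -
  have D2: "D2 u z s t = D2 u z t s" for s t
    unfolding D2_def
    using assms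
    by (intro second_derivative_symmetric[of \<Omega> z u "fderiv u"])
      (auto simp: C2_on_def intro: fderiv_has_derivative)
  have form: "inner (levi_op u z s) t = (D2 u z s t + D2 u z (scaleC \<i> s) (scaleC \<i> t)) / 4" for s t
    by (simp add: inner_eq_Re_cinner levi_op_representation levi_form_def)
  have "inner (levi_op u z s) t = inner (levi_op u z t) s" for s t
    unfolding form using D2[of s t] D2[of "scaleC \<i> s" "scaleC \<i> t"] by simp
  then show ?thesis
    unfolding symmetric_op_def by (metis inner_commute)
qed

lemma inner_levi_op_self:
  fixes u :: "'a::complex_hilbert_space \<Rightarrow> real"
  shows "D2 u z h h + D2 u z (scaleC \<i> h) (scaleC \<i> h) = 4 * inner (blinfun_apply (levi_op u z) h) h"
  by (simp add: inner_eq_Re_cinner levi_op_representation levi_form_def)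

text \<open>
  The left-hand side is the Laplacian, in the parameter \<open>c\<close> at \<open>0\<close>, of \<open>u (p + ckh)\<close>: multiplying the
  parameter by \<open>k\<close> rotates the complex line and scales the Laplacian by \<open>\<bar>k\<bar>\<^sup>2\<close>.
\<close>

lemma D2_rotation:
  fixes u :: "'a::complex_inner_space \<Rightarrow> real"
  shows "D2 u p (scaleC k h) (scaleC k h) + D2 u p (scaleC \<i> (scaleC k h)) (scaleC \<i> (scaleC k h))
    = (cmod k)\<^sup>2 * (D2 u p h h + D2 u p (scaleC \<i> h) (scaleC \<i> h))"
  unfolding scaleC_conv_scaleR[of k h] cmod_power2 D2_def
  by (simp add: scaleC_add_right scaleC_scaleR_right blinfun.bilinear_simps power2_eq_square
      algebra_simps)

lemma second_deriv_along_slice: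
  fixes u :: "'a::complex_inner_space \<Rightarrow> real"
  assumes "open \<Omega>" "C2_on \<Omega> u" and a: "z + scaleC a h \<in> \<Omega>"
  shows "second_deriv_along (\<lambda>x. u (z + scaleC x h)) a k
    (D2 u (z + scaleC a h) (scaleC k h) (scaleC k h))"
proof -
  define p w where "p = z + scaleC a h" and "w = scaleC k h"
  have arg: "z + scaleC (a + of_real t * k) h = p + t *\<^sub>R w" for t
    by (simp add: p_def w_def scaleC_add_left scaleR_eq_scaleC scaleC_scaleC add.assoc)
  obtain r where r: "0 < r" "ball p r \<subseteq> \<Omega>"
    using a \<open>open \<Omega>\<close> unfolding p_def by (meson openE)
  define d where "d = r / (norm w + 1)"
  have "0 < d" using r by (simp add: d_def add_nonneg_pos)
  have in_\<Omega>: "p + t *\<^sub>R w \<in> \<Omega>" if "\<bar>t\<bar> < d" for t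
  proof -
    have "\<bar>t\<bar> * norm w \<le> \<bar>t\<bar> * (norm w + 1)" by (intro mult_left_mono) auto
    also have "\<dots> < r" using that by (simp add: d_def pos_less_divide_eq add_nonneg_pos)
    finally have "p + t *\<^sub>R w \<in> ball p r" by (simp add: dist_norm)
    then show ?thesis using r(2) by blast
  qed
  have line: "((\<lambda>t. p + t *\<^sub>R w) has_derivative (\<lambda>h. h *\<^sub>R w)) (at t)" for t
    by (auto intro!: derivative_eq_intros)
  have 1: "((\<lambda>t. u (p + t *\<^sub>R w)) has_real_derivative blinfun_apply (fderiv u (p + t *\<^sub>R w)) w) (at t)"
    if "\<bar>t\<bar> < d" for t
  proof -
    have "(u has_derivative blinfun_apply (fderiv u (p + t *\<^sub>R w))) (at (p + t *\<^sub>R w))"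
      using assms(2) in_\<Omega>[OF that] by (auto simp: C2_on_def intro: fderiv_has_derivative)
    from has_derivative_compose[OF line this] show ?thesis
      unfolding has_field_derivative_def by (simp add: blinfun.scaleR_right mult_commute_abs)
  qed
  have 2: "((\<lambda>t. blinfun_apply (fderiv u (p + t *\<^sub>R w)) w) has_real_derivative D2 u p w w) (at 0)"
  proof -
    have "(fderiv u has_derivative blinfun_apply (fderiv (fderiv u) p)) (at (p + 0 *\<^sub>R w))"
      using assms(2) a by (auto simp: C2_on_def p_def intro: fderiv_has_derivative)
    from has_derivative_compose[OF line this]
    have "((\<lambda>t. fderiv u (p + t *\<^sub>R w)) has_derivative
        (\<lambda>h. h *\<^sub>R blinfun_apply (fderiv (fderiv u) p) w)) (at 0)"
      by (simp add: blinfun.scaleR_right)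
    from bounded_linear.has_derivative[OF blinfun.bounded_linear_left this, of w]
    show ?thesis
      unfolding has_field_derivative_def D2_def
      by (simp add: blinfun.scaleR_left mult_commute_abs)
  qed
  show ?thesis
    unfolding second_deriv_along_def arg p_def[symmetric] w_def[symmetric]
    by (intro exI[of _ "\<lambda>t. blinfun_apply (fderiv u (p + t *\<^sub>R w)) w"] exI[of _ d] conjI allI impI
        \<open>0 < d\<close> 1 2)
qed

lemma continuous_on_disc_slice:
  fixes w :: "'a::complex_inner_space \<Rightarrow> real"
  assumes "continuous_on S w" "\<And>c. c \<in> T \<Longrightarrow> z + scaleC c h \<in> S"
  shows "continuous_on T (\<lambda>c. w (z + scaleC c h))"
proof (rule continuous_on_compose2[OF assms(1)])
  show "continuous_on T (\<lambda>c. z + scaleC c h)"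
    by (intro continuous_intros linear_continuous_on bounded_linear_scaleC_left)
qed (use assms(2) in auto)

lemma le_circle_mean_of_laplacian_nonneg:
  fixes w :: "'a::complex_inner_space \<Rightarrow> real"
  assumes "continuous_on \<Omega> w" and disc: "\<And>c. cmod c \<le> 1 \<Longrightarrow> z + scaleC c h \<in> \<Omega>"
    and lap: "\<And>a. cmod a < 1 \<Longrightarrow> laplacian_nonneg_at (\<lambda>c. w (z + scaleC c h)) a"
  shows "ereal (w z) \<le> circle_mean (\<lambda>x. ereal (w x)) z h"
proof -
  have zero: "scaleC 0 h = 0" using scaleR_eq_scaleC[of 0 h] by simp
  have "2 * pi * w (z + scaleC 0 h) \<le> integral {0..2 * pi} (\<lambda>\<theta>. w (z + scaleC (cis \<theta>) h))"
    using laplacian_nonneg_mean_value[of "\<lambda>c. w (z + scaleC c h)"]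
      continuous_on_disc_slice[OF assms(1), of "cball 0 1" z h] disc lap by simp
  then have "w z \<le> 1 / (2 * pi) * integral {0..2 * pi} (\<lambda>\<theta>. w (z + scaleC (cis \<theta>) h))"
    by (simp add: zero field_simps)
  moreover have "continuous_on {0..2 * pi} (\<lambda>\<theta>. w (z + scaleC (cis \<theta>) h))"
    by (rule continuous_on_compose2[OF continuous_on_disc_slice[OF assms(1), of "cball 0 1" z h]])
      (use disc in \<open>auto intro!: continuous_intros\<close>)
  ultimately show ?thesis by (simp add: circle_mean_real)
qed

text \<open>
  If the form were negative in the direction \<open>h\<close>, then by continuity the Laplacian of \<open>-u\<close> along \<open>h\<close>
  would be bounded below by a positive constant on a small disc around \<open>z\<close>, so \<open>-u - \<delta>\<bar>c\<bar>\<^sup>2\<close> would still have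
  a nonnegative Laplacian.  Its sub-mean-value inequality contradicts that of \<open>u\<close>.
\<close>

lemma plurisubharmonic_imp_levi_op_nonneg:
  fixes u :: "'a::complex_hilbert_space \<Rightarrow> real"
  assumes "open \<Omega>" "z \<in> \<Omega>" and C2: "C2_on \<Omega> u"
    and psh: "plurisubharmonic_on \<Omega> (\<lambda>z. ereal (u z))"
  shows "0 \<le> inner (blinfun_apply (levi_op u z) h) h"
proof (rule ccontr)
  define L where "L = (\<lambda>p h. D2 u p h h + D2 u p (scaleC \<i> h) (scaleC \<i> h))"
  assume "\<not> 0 \<le> inner (blinfun_apply (levi_op u z) h) h"
  then have neg: "L z h < 0" unfolding L_def inner_levi_op_self by simp
  have "continuous_on \<Omega> (\<lambda>p. L p h)"
    using C2 unfolding L_def D2_def C2_on_def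
    by (intro continuous_intros) auto
  then have "isCont (\<lambda>p. L p h) z"
    using \<open>open \<Omega>\<close> \<open>z \<in> \<Omega>\<close> continuous_on_eq_continuous_at by blast
  then have "\<forall>\<^sub>F p in nhds z. L p h < L z h / 2"
    using neg by (intro order_tendstoD(2)[of _ "L z h"])
      (simp_all add: continuous_at flip: tendsto_at_iff_tendsto_nhds[of "\<lambda>p. L p h" z])
  moreover have "\<forall>\<^sub>F p in nhds z. p \<in> \<Omega>"
    using \<open>open \<Omega>\<close> \<open>z \<in> \<Omega>\<close> by (rule eventually_nhds_in_open)
  ultimately have "\<forall>\<^sub>F p in nhds z. L p h < L z h / 2 \<and> p \<in> \<Omega>" by (rule eventually_conj)
  then obtain r where r: "0 < r" "\<And>p. dist p z < r \<Longrightarrow> L p h < L z h / 2 \<and> p \<in> \<Omega>"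
    unfolding eventually_nhds_metric by blast
  define s where "s = r / (norm h + 1)"
  define h' where "h' = s *\<^sub>R h"
  have "0 < s" using r by (simp add: s_def add_nonneg_pos)
  have "s * norm h < r"
  proof -
    have "s * norm h < s * (norm h + 1)" using \<open>0 < s\<close> by simp
    moreover have "norm h + 1 \<noteq> 0" using norm_ge_zero[of h] by linarith
    then have "s * (norm h + 1) = r" by (simp add: s_def)
    ultimately show ?thesis by simp
  qed
  then have near: "dist (z + scaleC c h') z < r" if "cmod c \<le> 1" for c
  proof -
    have "cmod c * (s * norm h) \<le> 1 * (s * norm h)"
      using that \<open>0 < s\<close> by (intro mult_right_mono) auto
    also have "\<dots> < r" using \<open>s * norm h < r\<close> by simp
    finally have "cmod c * (s * norm h) < r" .
    moreover have "dist (z + scaleC c h') z = cmod c * (s * norm h)"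
      using \<open>0 < s\<close> by (simp add: dist_norm norm_scaleC h'_def)
    ultimately show ?thesis by simp
  qed
  have disc: "z + scaleC c h' \<in> \<Omega>" if "cmod c \<le> 1" for c
    using r(2)[OF near[OF that]] by blast
  have L_scale: "L p h' = s\<^sup>2 * L p h" for p
    by (simp add: L_def h'_def D2_def scaleC_scaleR_right blinfun.bilinear_simps power2_eq_square
        algebra_simps)
  \<comment> \<open>the square \<open>-\<delta>\<bar>c\<bar>\<^sup>2\<close> contributes \<open>-4\<delta>\<close> to the Laplacian, minus half of the value \<open>-s\<^sup>2 L z h\<close> of
    the Laplacian of \<open>-u\<close> at the centre\<close>
  define \<delta> where "\<delta> = - (s\<^sup>2 * L z h) / 8"
  have "0 < \<delta>" using neg \<open>0 < s\<close> by (simp add: \<delta>_def mult_pos_neg)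
  define f where "f = (\<lambda>c. (-1) * u (z + scaleC c h') + (- \<delta>) * (cmod c)\<^sup>2)"
  have mean: "2 * pi * f 0 \<le> integral {0..2 * pi} (\<lambda>\<theta>. f (cis \<theta>))"
  proof (rule laplacian_nonneg_mean_value)
    show "continuous_on (cball 0 1) f"
      unfolding f_def using disc
      by (intro continuous_intros continuous_on_disc_slice[OF C2_on_continuous_on[OF C2]]) auto
    fix a :: complex assume "a \<in> ball 0 1"
    then have a: "cmod a \<le> 1" by simp
    let ?p = "z + scaleC a h'"
    define q where "q = (\<lambda>k. (-1) * D2 u ?p (scaleC k h') (scaleC k h') + 2 * (- \<delta>) * (cmod k)\<^sup>2)"
    have "second_deriv_along f a k (q k)" for k
      unfolding f_def q_def
      by (intro second_deriv_along_add second_deriv_along_scale second_deriv_along_norm_square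
          second_deriv_along_slice[OF \<open>open \<Omega>\<close> C2 disc[OF a]])
    moreover have "0 \<le> q k + q (\<i> * k)" for k
    proof -
      have "q k + q (\<i> * k) = - ((cmod k)\<^sup>2 * L ?p h') - 4 * \<delta> * (cmod k)\<^sup>2"
        using D2_rotation[of u ?p k h'] by (simp add: q_def L_def norm_mult scaleC_scaleC algebra_simps)
      also have "\<dots> = (cmod k)\<^sup>2 * s\<^sup>2 * (L z h / 2 - L ?p h)"
        by (simp add: L_scale \<delta>_def algebra_simps)
      also have "\<dots> \<ge> 0"
        using r(2)[OF near[OF a]] by (intro mult_nonneg_nonneg) auto
      finally show ?thesis .
    qed
    ultimately show "laplacian_nonneg_at f a" unfolding laplacian_nonneg_at_def by blast
  qed
  define g where "g = (\<lambda>\<theta>. u (z + scaleC (cis \<theta>) h'))"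
  have g: "continuous_on {0..2 * pi} g"
    unfolding g_def
    by (rule continuous_on_compose2[OF
          continuous_on_disc_slice[OF C2_on_continuous_on[OF C2], of "cball 0 1" z h']])
      (use disc in \<open>auto intro!: continuous_intros\<close>)
  have int_f: "integral {0..2 * pi} (\<lambda>\<theta>. f (cis \<theta>)) = - integral {0..2 * pi} g - 2 * pi * \<delta>"
  proof -
    have "(\<lambda>\<theta>. f (cis \<theta>)) = (\<lambda>\<theta>. - g \<theta> - \<delta>)" by (simp add: f_def g_def)
    moreover have "((\<lambda>\<theta>. - g \<theta> - \<delta>) has_integral
        (- integral {0..2 * pi} g - (2 * pi - 0) *\<^sub>R \<delta>)) {0..2 * pi}"
      using has_integral_const_real[of \<delta> 0 "2 * pi"]
      by (intro has_integral_diff has_integral_neg integrable_integral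
          integrable_continuous_real[OF g]) simp
    ultimately show ?thesis by (simp add: integral_unique)
  qed
  have f0: "f 0 = - u z"
    using scaleR_eq_scaleC[of 0 h'] by (simp add: f_def)
  have "u z \<le> 1 / (2 * pi) * integral {0..2 * pi} g"
  proof -
    have "ereal (u z) \<le> circle_mean (\<lambda>z. ereal (u z)) z h'"
      using psh \<open>z \<in> \<Omega>\<close> disc unfolding plurisubharmonic_on_def by blast
    then show ?thesis using circle_mean_real[of u z h'] g by (simp add: g_def)
  qed
  then have "2 * pi * u z \<le> integral {0..2 * pi} g"
    by (simp add: field_simps)
  then have "2 * pi * \<delta> \<le> 0" using mean unfolding int_f f0 by simp
  moreover have "0 < 2 * pi * \<delta>" using \<open>0 < \<delta>\<close> by simp
  ultimately show False by linarith
qed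

section \<open>Plurisubharmonicity and the comparison theorem\<close>

text \<open>
  A complex line through \<open>z\<close> meets the closure of the bounded set \<open>\<Omega>\<close> in a compact set, and leaves
  \<open>\<Omega>\<close> only through the frontier.
\<close>

lemma slice_max_principle:
  fixes w :: "'a::complex_inner_space \<Rightarrow> real"
  assumes nontrivial: "\<exists>x::'a. x \<noteq> 0" and "open \<Omega>" "bounded \<Omega>"
    and cont: "continuous_on (closure \<Omega>) w"
    and lap: "\<And>z h a. z + scaleC a h \<in> \<Omega> \<Longrightarrow> laplacian_nonneg_at (\<lambda>c. w (z + scaleC c h)) a"
    and bdry: "\<And>z. z \<in> frontier \<Omega> \<Longrightarrow> w z \<le> b" and "z \<in> \<Omega>"
  shows "w z \<le> b"
proof -
  obtain h :: 'a where "h \<noteq> 0" using nontrivial by blast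
  define \<phi> where "\<phi> = (\<lambda>c. z + scaleC c h)"
  have \<phi>_cont: "continuous_on UNIV \<phi>"
    unfolding \<phi>_def by (intro continuous_intros linear_continuous_on bounded_linear_scaleC_left)
  define K U where "K = \<phi> -` closure \<Omega>" and "U = \<phi> -` \<Omega>"
  have "closed K"
    unfolding K_def using \<phi>_cont by (simp add: continuous_closed_vimage continuous_on_eq_continuous_at)
  moreover have "bounded K"
  proof -
    obtain R where R: "\<And>x. x \<in> closure \<Omega> \<Longrightarrow> norm x \<le> R"
      using bounded_closure[OF \<open>bounded \<Omega>\<close>] by (auto simp: bounded_iff)
    have "cmod c \<le> (R + norm z) / norm h" if "c \<in> K" for c
    proof -
      have "norm (scaleC c h) \<le> norm (\<phi> c) + norm z"
        using norm_triangle_ineq4[of "\<phi> c" z] by (simp add: \<phi>_def)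
      also have "\<dots> \<le> R + norm z" using R that by (simp add: K_def)
      finally show ?thesis using \<open>h \<noteq> 0\<close> by (simp add: norm_scaleC field_simps)
    qed
    then show ?thesis by (auto simp: bounded_iff)
  qed
  ultimately have "compact K" by (simp add: compact_eq_bounded_closed)
  have "open U"
    unfolding U_def using \<phi>_cont \<open>open \<Omega>\<close> by (simp add: open_vimage)
  have "U \<subseteq> K" using closure_subset by (auto simp: U_def K_def)
  have zero: "\<phi> 0 = z" using scaleR_eq_scaleC[of 0 h] by (simp add: \<phi>_def)
  have "w (\<phi> 0) \<le> b"
  proof (rule laplacian_nonneg_max_principle[where f = "\<lambda>c. w (\<phi> c)" and K = K and U = U])
    show "continuous_on K (\<lambda>c. w (\<phi> c))"
      by (rule continuous_on_compose2[OF cont continuous_on_subset[OF \<phi>_cont]]) (auto simp: K_def)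
    show "laplacian_nonneg_at (\<lambda>c. w (\<phi> c)) a" if "a \<in> U" for a
      using that lap by (simp add: U_def \<phi>_def)
    show "w (\<phi> c) \<le> b" if "c \<in> K - U" for c
      using that bdry \<open>open \<Omega>\<close> by (simp add: K_def U_def frontier_def interior_open)
    show "0 \<in> K" using zero \<open>z \<in> \<Omega>\<close> closure_subset by (auto simp: K_def)
  qed fact+
  then show ?thesis by (simp add: zero)
qed

lemma plurisubharmonic_of_laplacian_nonneg:
  fixes w :: "'a::complex_inner_space \<Rightarrow> real"
  assumes cont: "continuous_on \<Omega> w"
    and lap: "\<And>z h a. z + scaleC a h \<in> \<Omega> \<Longrightarrow> laplacian_nonneg_at (\<lambda>c. w (z + scaleC c h)) a"
  shows "plurisubharmonic_on \<Omega> (\<lambda>z. ereal (w z))"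
  unfolding plurisubharmonic_on_def
proof (intro conjI ballI allI impI)
  show "usc_on \<Omega> (\<lambda>z. ereal (w z))"
    unfolding usc_on_def
  proof (intro ballI allI impI)
    fix z c assume "z \<in> \<Omega>" "ereal (w z) < c"
    have "((\<lambda>z. ereal (w z)) \<longlongrightarrow> ereal (w z)) (at z within \<Omega>)"
      using cont \<open>z \<in> \<Omega>\<close> by (auto simp: continuous_on_def)
    then show "\<forall>\<^sub>F x in at z within \<Omega>. ereal (w x) < c"
      using \<open>ereal (w z) < c\<close> by (rule order_tendstoD(2))
  qed
  show "\<exists>z\<in>C. ereal (w z) \<noteq> -\<infinity>" if "C \<in> components \<Omega>" for C
    using in_components_nonempty[OF that] by auto
  fix z h assume "\<forall>c. cmod c \<le> 1 \<longrightarrow> z + scaleC c h \<in> \<Omega>"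
  then show "ereal (w z) \<le> circle_mean (\<lambda>z. ereal (w z)) z h"
    by (intro le_circle_mean_of_laplacian_nonneg[OF cont] lap) auto
qed auto

lemma op_le_scaleR_id:
  fixes A :: "'a::complex_inner_space \<Rightarrow>\<^sub>L 'a"
  shows "op_le (m *\<^sub>R id_blinfun) A \<Longrightarrow> m * (norm x)\<^sup>2 \<le> inner (blinfun_apply A x) x"
    and "op_le A (m *\<^sub>R id_blinfun) \<Longrightarrow> inner (blinfun_apply A x) x \<le> m * (norm x)\<^sup>2"
proof -
  have nonneg: "0 \<le> inner (blinfun_apply (C - B) x) x" if "op_le B C" for B C :: "'a \<Rightarrow>\<^sub>L 'a"
    using that unfolding op_le_def inner_eq_Re_cinner
    by (metis complex_nonneg_Reals_iff)
  show "m * (norm x)\<^sup>2 \<le> inner (blinfun_apply A x) x" if "op_le (m *\<^sub>R id_blinfun) A"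
    using nonneg[OF that]
    by (simp add: blinfun.diff_left blinfun.scaleR_left inner_diff_left power2_norm_eq_inner)
  show "inner (blinfun_apply A x) x \<le> m * (norm x)\<^sup>2" if "op_le A (m *\<^sub>R id_blinfun)"
    using nonneg[OF that]
    by (simp add: blinfun.diff_left blinfun.scaleR_left inner_diff_left power2_norm_eq_inner)
qed

theorem theorem6p1:
  fixes \<Omega> :: "'a::complex_hilbert_space set"
    and u v :: "'a \<Rightarrow> real"
    and m M :: real
  assumes "\<exists>x::'a. x \<noteq> 0"
    and "open \<Omega>" and "connected \<Omega>" and "\<Omega> \<noteq> {}" and "bounded \<Omega>"
    and "plurisubharmonic_on \<Omega> (\<lambda>z. ereal (u z))" and "C2_closure \<Omega> u"
    and "plurisubharmonic_on \<Omega> (\<lambda>z. ereal (v z))" and "C2_closure \<Omega> v"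
    and "0 < m" and "m \<le> M"
    and "\<And>z. z \<in> \<Omega> \<Longrightarrow> op_le (m *\<^sub>R id_blinfun) (levi_op v z)"
    and "\<And>z. z \<in> \<Omega> \<Longrightarrow> op_le (levi_op v z) (M *\<^sub>R id_blinfun)"
    and "\<And>z x. z \<in> \<Omega> \<Longrightarrow> norm x = 1 \<Longrightarrow> fs_det x (levi_op v z) \<le> fs_det x (levi_op u z)"
    and "\<And>z. z \<in> frontier \<Omega> \<Longrightarrow> specht (M / m) * u z \<le> v z"
  shows "plurisubharmonic_on \<Omega> (\<lambda>z. ereal (specht (M / m) * u z - v z))
    \<and> (\<forall>z\<in>\<Omega>. specht (M / m) * u z - v z \<le> 0)"
proof -
  define S where "S = specht (M / m)"
  note C2 = C2_closure_imp_C2_on[OF assms(7)] C2_closure_imp_C2_on[OF assms(9)]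
  have levi: "inner (levi_op v z h) h \<le> S * inner (levi_op u z h) h" if "z \<in> \<Omega>" for z h
    unfolding S_def
  proof (rule form_le_specht_form)
    show "symmetric_op (levi_op v z)" "symmetric_op (levi_op u z)"
      using symmetric_levi_op[OF \<open>open \<Omega>\<close> that] C2 by auto
    show "0 \<le> inner (levi_op u z x) x" for x
      using plurisubharmonic_imp_levi_op_nonneg[OF \<open>open \<Omega>\<close> that C2(1) assms(6)] .
    show "m * (norm x)\<^sup>2 \<le> inner (levi_op v z x) x" for x
      by (rule op_le_scaleR_id(1)[OF assms(12)[OF that]])
    show "inner (levi_op v z x) x \<le> M * (norm x)\<^sup>2" for x
      by (rule op_le_scaleR_id(2)[OF assms(13)[OF that]])
    show "fs_det x (levi_op v z) \<le> fs_det x (levi_op u z)" if "norm x = 1" for x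
      using assms(14)[OF \<open>z \<in> \<Omega>\<close> that] .
  qed fact+
  define w where "w = (\<lambda>z. S * u z + (-1) * v z)"
  have lap: "laplacian_nonneg_at (\<lambda>c. w (z + scaleC c h)) a" if a: "z + scaleC a h \<in> \<Omega>" for z h a
  proof -
    let ?p = "z + scaleC a h"
    define q where "q = (\<lambda>k. S * D2 u ?p (scaleC k h) (scaleC k h)
      + (-1) * D2 v ?p (scaleC k h) (scaleC k h))"
    have "second_deriv_along (\<lambda>c. w (z + scaleC c h)) a k (q k)" for k
      unfolding w_def q_def
      by (intro second_deriv_along_add second_deriv_along_scale
          second_deriv_along_slice[OF \<open>open \<Omega>\<close> _ a] C2)
    moreover have "0 \<le> q k + q (\<i> * k)" for k
    proof -
      have "q k + q (\<i> * k) = S * (4 * inner (levi_op u ?p (scaleC k h)) (scaleC k h))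
          - 4 * inner (levi_op v ?p (scaleC k h)) (scaleC k h)"
        by (simp add: q_def scaleC_scaleC algebra_simps flip: inner_levi_op_self)
      then show ?thesis using levi[OF a, of "scaleC k h"] by simp
    qed
    ultimately show ?thesis unfolding laplacian_nonneg_at_def by blast
  qed
  have cont: "continuous_on (closure \<Omega>) w"
    unfolding w_def using assms(7,9) by (intro continuous_intros) (auto simp: C2_closure_def)
  have "plurisubharmonic_on \<Omega> (\<lambda>z. ereal (w z))"
    using continuous_on_subset[OF cont closure_subset] lap
    by (rule plurisubharmonic_of_laplacian_nonneg)
  moreover have "w z \<le> 0" if "z \<in> \<Omega>" for z
    by (rule slice_max_principle[OF assms(1,2,5) cont lap _ that])
      (use assms(15) in \<open>auto simp: w_def S_def\<close>)
  ultimately show ?thesis by (simp add: w_def S_def)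
qed

end
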